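(* Let $k\ge 3$ and $1\le s\le k-1$ be fixed integers. Then, as $n\to\infty$, $$A_{k,s}(n) = C_{k,s}\, f_{k,s}(n)\,\frac{n^{k-1}}{(k-1)!} + \begin{cases} O\left(n^{k-2}(\log n)^{\max(s,k-s)}\right), & \text{if } k\ge 4,\\ O\left(n(\log n)^2\log\log n\right), & \text{if } k=3,\end{cases}$$ where $$C_{k,s}=\prod_p\left(1-\frac{F_{k,s}(p)}{p^{k-1}}\right),\qquad f_{k,s}(n)=\prod_{p\mid n}\left(1+\frac{(-1)^{k-1}}{p^{k-1}-F_{k,s}(p)}\right),$$ the first product running over all primes $p$ and the second over the primes $p$ dividing $n$.
   Context: $\mathbb{N}=\{1,2,\ldots\}$. For $1\le s\le k-1$, $$A_{k,s}(n)=\#\{(x_1,\ldots,x_k)\in\mathbb{N}^k : x_1+\cdots+x_k=n,\ \gcd(x_1\cdots x_s,\,x_{s+1}\cdots x_k)=1\}.$$ For $k\ge 3$ and $1\le s\le k-1$, $$F_{k,s}(x)=\frac1x\left(x^k+(x-1)^k-x^s(x-1)^{k-s}-x^{k-s}(x-1)^s+(-1)^{k-1}\right),$$ which is a polynomial in $x$ of degree $k-3$. The implied constants in the $O$-terms may depend on $k$ and $s$ but not on $n$. *)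

theory Defs
  imports "HOL-Analysis.Analysis" "HOL-Library.Landau_Symbols"
    "HOL-Computational_Algebra.Primes"
begin

(* k-tuples of positive integers are extensional functions on {1..k}. *)
definition A_ks :: "nat \<Rightarrow> nat \<Rightarrow> nat \<Rightarrow> nat" where
  "A_ks k s n = card {x :: nat \<Rightarrow> nat. x \<in> {1..k} \<rightarrow>\<^sub>E {1..} \<and> (\<Sum>i=1..k. x i) = n \<and>
                     gcd (\<Prod>i=1..s. x i) (\<Prod>i=s+1..k. x i) = 1}"

(* For k >= 3 this is a polynomial function away from x = 0; only prime x are used. *)
definition F_ks :: "nat \<Rightarrow> nat \<Rightarrow> real \<Rightarrow> real" where
  "F_ks k s x = 1 / x * (x ^ k + (x - 1) ^ k - x ^ s * (x - 1) ^ (k - s)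
                        - x ^ (k - s) * (x - 1) ^ s + (-1) ^ (k - 1))"

(* The product over all primes, as a product over the naturals with factor 1 off the primes. *)
definition C_ks :: "nat \<Rightarrow> nat \<Rightarrow> real" where
  "C_ks k s = prodinf (\<lambda>p. if prime p then 1 - F_ks k s (real p) / real p ^ (k - 1) else 1)"

definition f_ks :: "nat \<Rightarrow> nat \<Rightarrow> nat \<Rightarrow> real" where
  "f_ks k s n = (\<Prod>p | prime p \<and> p dvd n.
                1 + (-1) ^ (k - 1) / (real p ^ (k - 1) - F_ks k s (real p)))"

end

theory Submission
  imports Defs "HOL-Number_Theory.Cong"
begin

text \<open>
  Write \<open>X\<close> and \<open>Y\<close> for the two groups of coordinates, \<open>V = X \<union> Y\<close> and \<open>k = card V\<close>.  Coprimality of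
  the two products fails at a prime \<open>p\<close> exactly when \<open>p\<close> divides a coordinate in \<open>X\<close> and a
  coordinate in \<open>Y\<close>.  Inclusion-exclusion at every prime \<open>p \<le> n\<close> over the set \<open>T\<close> of coordinates
  that are required to be divisible by \<open>p\<close> (the type of \<open>p\<close>) turns the count into a signed sum,
  over all assignments \<open>S\<close> of types to primes, of numbers of positive solutions of
  \<open>(\<Sum>i\<in>V. x i) = n\<close> with prescribed prime divisors.  Every such number is
  \<open>n ^ (k - 1) / fact (k - 1)\<close> times a product of local densities, up to an error.  Summed over \<open>S\<close>,
  the main terms factor into a product over the primes, which is the singular series up to
  \<open>O(1 / n)\<close>.

  The work is in the error terms.  Placing the coordinates one after the other gives an explicit
  error bound, and it does so for every order of the coordinates
  (\<open>card_lattice_points_asymptotic\<close>).  Let \<open>d T\<close> be the product of the primes of type \<open>T\<close>.  The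
  bound is a sum, over the stages of the placement, of products of powers of the numbers
  \<open>1 / d T\<close>.  The map from \<open>S\<close> to \<open>d\<close> is injective, and there is no solution at all when some
  \<open>d T\<close> exceeds \<open>n\<close>.  Hence the sum over \<open>S\<close> is at most a sum over independent integers
  \<open>d T \<le> n\<close> (\<open>weighted_count_asymptotic\<close>): a type of exponent 1 costs a factor \<open>1 + ln n\<close>, a type
  of exponent at least 5/4 costs a constant.  So the power of the logarithm is the number of types
  whose exponent is 1.  At the typical stage these are the pairs that consist of the coordinate
  being placed and a coordinate of the opposite group, which is where \<open>max s (k - s)\<close> comes from.

  Only the first stages are different.  If one group is a single coordinate \<open>y\<close>, the order in which
  \<open>y\<close> is placed last is good enough (\<open>total_error_bounded_singleton\<close>).  For \<open>k = 3\<close> the type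
  \<open>{a, b, y}\<close> would cost a third logarithm.  It disappears because \<open>x a + x b + x y = n\<close>: if \<open>p\<close>
  divides two of the three coordinates, it divides the third one exactly when it divides \<open>n\<close>.

  If both groups have at least two coordinates, choose \<open>x1, x2 \<in> X\<close> and \<open>y1, y2 \<in> Y\<close>.  An order that
  starts with \<open>x1\<close> and \<open>y1\<close> has at its first stage the exponents 0, 1, 1, 2 at the types \<open>{x1, y1}\<close>,
  \<open>{x1, y2}\<close>, \<open>{x2, y1}\<close>, \<open>{x2, y2}\<close>; compared with exponent 1 throughout, the weight changes by
  the factor \<open>d {x1, y1} / d {x2, y2}\<close>.  Four such starts are available, with the ratios
  \<open>d {x1, y1} / d {x2, y2}\<close> and \<open>d {x1, y2} / d {x2, y1}\<close> and their inverses, and the best start can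
  be chosen separately for every \<open>S\<close>.  A sum of \<open>1 / (a b)\<close> over \<open>a, b \<le> n\<close>, damped by a positive
  power of \<open>min (a / b) (b / a)\<close>, is only of order \<open>ln n\<close>, so that the first stage costs two
  logarithms in total (\<open>total_error_bounded_straddling\<close>).  Since \<open>max s (k - s) \<ge> 2\<close>, this is
  affordable.  In all cases the error is \<open>O(n ^ (k - 2) * ln n ^ max s (k - s))\<close>.
\<close>

section \<open>Powers in a residue class\<close>

lemma primes_prod_dvd_iff:
  fixes x :: nat
  assumes "finite A" "\<And>p. p \<in> A \<Longrightarrow> prime p"
  shows "\<Prod>A dvd x \<longleftrightarrow> (\<forall>p\<in>A. p dvd x)"
proof
  assume "\<Prod>A dvd x"
  with \<open>finite A\<close> show "\<forall>p\<in>A. p dvd x"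
    by (meson dvd_prodI dvd_trans)
next
  assume "\<forall>p\<in>A. p dvd x"
  then have "[x = 0] (mod (\<Prod>p\<in>A. p))"
    using assms by (intro coprime_cong_prod_nat) (auto simp: cong_0_iff intro: primes_coprime_nat)
  then show "\<Prod>A dvd x"
    by (simp add: cong_0_iff)
qed

text \<open>
  Moving \<open>N\<close> up by \<open>q\<close> adds exactly one power \<open>R ^ r\<close> with \<open>N \<le> R < N + q\<close> to the sum, and the
  mean of \<open>t ^ r\<close> over that interval to the main term.  The two differ by at most
  \<open>(N + q) ^ r - N ^ r\<close>, and these differences telescope.
\<close>

lemma power_sum_residue_class:
  fixes a q r N :: nat
  assumes "q > 0"
  shows "\<bar>(\<Sum>R | 0 < R \<and> R < N \<and> [R = a] (mod q). real R ^ r) - real N ^ (r + 1) / (real (r + 1) * real q)\<bar>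
           \<le> real N ^ r"
proof (induction N rule: less_induct)
  case (less N)
  define A where "A = (\<lambda>N. {R. 0 < R \<and> R < N \<and> [R = a] (mod q)})"
  have fin: "finite (A M)" for M
    by (rule finite_subset[of _ "{..<M}"]) (auto simp: A_def)
  have block: "\<exists>R. {R. M \<le> R \<and> R < M + q \<and> [R = a] (mod q)} = {R}" for M
  proof -
    have "\<exists>R\<ge>M. R < M + q \<and> [R = a] (mod q)"
    proof (intro exI conjI)
      show "M + (a + (q - 1) * M) mod q \<ge> M" by simp
      show "M + (a + (q - 1) * M) mod q < M + q" using assms by simp
      have "[M + (a + (q - 1) * M) mod q = M + (a + (q - 1) * M)] (mod q)"
        by (intro cong_add) (auto simp: cong_def)
      also have "M + (a + (q - 1) * M) = a + q * M"
        using assms by (cases q) auto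
      also have "[a + q * M = a] (mod q)" by (simp add: cong_def)
      finally show "[M + (a + (q - 1) * M) mod q = a] (mod q)" .
    qed
    moreover have "R = R'" if "M \<le> R" "R < M + q" "M \<le> R'" "R' < M + q" "[R = R'] (mod q)" for R R'
    proof -
      have "R - M = R' - M"
      proof (rule cong_less_modulus_unique_nat)
        show "[R - M = R' - M] (mod q)"
          using that by (metis cong_add_lcancel_nat le_add_diff_inverse)
      qed (use that in auto)
      with that show ?thesis by simp
    qed
    ultimately show ?thesis
      by (auto simp: set_eq_iff) (metis cong_sym cong_trans)
  qed
  show ?case
  proof (cases "N \<le> q")
    case True
    have "A N \<subseteq> {R. 0 \<le> R \<and> R < 0 + q \<and> [R = a] (mod q)}" using True by (auto simp: A_def)
    then obtain R where R: "A N \<subseteq> {R}" using block[of 0] by metis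
    have "(\<Sum>R\<in>A N. real R ^ r) \<le> real N ^ r"
    proof (cases "A N = {}")
      case False
      then have "A N = {R}" using R by auto
      then have "R < N" by (auto simp: A_def)
      with \<open>A N = {R}\<close> show ?thesis by (auto intro!: power_mono)
    qed auto
    moreover have "(\<Sum>R\<in>A N. real R ^ r) \<ge> 0" by (intro sum_nonneg) auto
    moreover have "real N ^ (r + 1) / (real (r + 1) * real q) \<le> real N ^ r"
    proof -
      have "real N \<le> real q" using True by simp
      also have "real q \<le> real (r + 1) * real q" by (simp add: algebra_simps)
      finally have "real N ^ r * real N \<le> real N ^ r * (real (r + 1) * real q)"
        by (intro mult_left_mono) auto
      then show ?thesis using assms by (simp add: divide_le_eq mult_ac)
    qed
    moreover have "real N ^ (r + 1) / (real (r + 1) * real q) \<ge> 0" by simp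
    ultimately show ?thesis unfolding A_def by linarith
  next
    case False
    define M where "M = N - q"
    have N: "N = M + q" and "M < N" and "M > 0" using False assms by (auto simp: M_def)
    obtain R where R: "{R. M \<le> R \<and> R < M + q \<and> [R = a] (mod q)} = {R}" using block by blast
    have Rb: "M \<le> R" "R < N" using R N by auto
    have "A N = A M \<union> {R. M \<le> R \<and> R < M + q \<and> [R = a] (mod q)}"
      using \<open>M > 0\<close> by (auto simp: A_def N)
    then have AN: "A N = insert R (A M)" unfolding R by simp
    have RM: "R \<notin> A M" using Rb by (auto simp: A_def)
    have "(\<Sum>R\<in>A N. real R ^ r) = real R ^ r + (\<Sum>R\<in>A M. real R ^ r)"
      using fin RM by (simp add: AN)
    moreover have "real M ^ r \<le> real R ^ r" "real R ^ r \<le> real N ^ r"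
      using Rb by (auto intro!: power_mono)
    moreover have "real M ^ r \<le> (real N ^ (r + 1) - real M ^ (r + 1)) / (real (r + 1) * real q)
        \<and> (real N ^ (r + 1) - real M ^ (r + 1)) / (real (r + 1) * real q) \<le> real N ^ r"
    proof -
      have eq: "real N ^ (r + 1) - real M ^ (r + 1)
             = real q * (\<Sum>i<r+1. real N ^ i * real M ^ (r - i))"
        by (subst power_diff_sumr2) (simp add: N mult_ac)
      have b: "real M ^ r \<le> real N ^ i * real M ^ (r - i) \<and> real N ^ i * real M ^ (r - i) \<le> real N ^ r"
        if "i < r + 1" for i
      proof -
        have "real M ^ i * real M ^ (r - i) \<le> real N ^ i * real M ^ (r - i)"
          using N by (intro mult_right_mono power_mono) auto
        moreover have "real N ^ i * real M ^ (r - i) \<le> real N ^ i * real N ^ (r - i)"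
          using N by (intro mult_left_mono power_mono) auto
        ultimately show ?thesis using that by (simp flip: power_add)
      qed
      have "(\<Sum>i<r+1. real M ^ r) \<le> (\<Sum>i<r+1. real N ^ i * real M ^ (r - i))"
        by (rule sum_mono) (use b in blast)
      moreover have "(\<Sum>i<r+1. real N ^ i * real M ^ (r - i)) \<le> (\<Sum>i<r+1. real N ^ r)"
        by (rule sum_mono) (use b in blast)
      ultimately show ?thesis
        unfolding eq using assms by (simp add: le_divide_eq divide_le_eq mult_ac del: sum.lessThan_Suc)
    qed
    moreover have "\<bar>(\<Sum>R\<in>A M. real R ^ r) - real M ^ (r + 1) / (real (r + 1) * real q)\<bar> \<le> real M ^ r"
      using less.IH[OF \<open>M < N\<close>] by (simp add: A_def)
    ultimately have "\<bar>(\<Sum>R\<in>A N. real R ^ r) - real N ^ (r + 1) / (real (r + 1) * real q)\<bar> \<le> real N ^ r"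
      unfolding diff_divide_distrib by linarith
    then show ?thesis by (simp only: A_def)
  qed
qed

section \<open>Solutions with prescribed prime divisors\<close>

definition lattice_points ::
    "nat set \<Rightarrow> (nat \<Rightarrow> 'a set) \<Rightarrow> 'a set \<Rightarrow> nat \<Rightarrow> ('a \<Rightarrow> nat) set" where
  "lattice_points Q S V N =
     {x \<in> V \<rightarrow>\<^sub>E {1..}. sum x V = N \<and> (\<forall>p\<in>Q. \<forall>i\<in>V \<inter> S p. p dvd x i)}"

lemma finite_lattice_points:
  assumes "finite V"
  shows "finite (lattice_points Q S V N)"
proof (rule finite_subset)
  show "lattice_points Q S V N \<subseteq> V \<rightarrow>\<^sub>E {..N}"
  proof
    fix x assume x: "x \<in> lattice_points Q S V N"
    have "x i \<le> N" if "i \<in> V" for i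
      using x member_le_sum[of i V x] that assms by (auto simp: lattice_points_def)
    with x show "x \<in> V \<rightarrow>\<^sub>E {..N}" by (auto simp: lattice_points_def PiE_iff)
  qed
  show "finite (V \<rightarrow>\<^sub>E {..N})" using assms by (intro finite_PiE) auto
qed

lemma card_lattice_points_insert:
  assumes "finite V" "z \<notin> V" "V \<noteq> {}"
  shows "card (lattice_points Q S (insert z V) N) =
           (\<Sum>x | 0 < x \<and> x < N \<and> (\<forall>p\<in>Q. z \<in> S p \<longrightarrow> p dvd x). card (lattice_points Q S V (N - x)))"
proof -
  define D where "D = {x. 0 < x \<and> x < N \<and> (\<forall>p\<in>Q. z \<in> S p \<longrightarrow> p dvd x)}"
  have "finite D" by (rule finite_subset[of _ "{..N}"]) (auto simp: D_def)
  have pos: "sum f V > 0" if "f \<in> V \<rightarrow>\<^sub>E {1..}" for f :: "'a \<Rightarrow> nat"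
  proof -
    from assms obtain i where "i \<in> V" by auto
    with that have "1 \<le> f i" by auto
    also have "f i \<le> sum f V" using \<open>i \<in> V\<close> assms by (intro member_le_sum) auto
    finally show ?thesis by simp
  qed
  have "bij_betw (\<lambda>f. (f z, f(z := undefined))) (lattice_points Q S (insert z V) N)
          (Sigma D (\<lambda>x. lattice_points Q S V (N - x)))"
  proof (rule bij_betw_byWitness[where f' = "\<lambda>(x, f). f(z := x)"])
    show "(\<lambda>f. (f z, f(z := undefined))) ` lattice_points Q S (insert z V) N
            \<subseteq> Sigma D (\<lambda>x. lattice_points Q S V (N - x))"
    proof (rule image_subsetI)
      fix f assume f: "f \<in> lattice_points Q S (insert z V) N"
      let ?g = "f(z := undefined)"
      have g: "?g \<in> V \<rightarrow>\<^sub>E {1..}" using f assms by (auto simp: lattice_points_def PiE_def extensional_def)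
      have s: "sum ?g V = sum f V" using assms by (intro sum.cong) auto
      have "N = f z + sum f V" using f assms by (auto simp: lattice_points_def)
      with s pos[OF g] f g assms show "(f z, ?g) \<in> Sigma D (\<lambda>x. lattice_points Q S V (N - x))"
        by (auto simp: lattice_points_def D_def)
    qed
    show "(\<lambda>(x, f). f(z := x)) ` Sigma D (\<lambda>x. lattice_points Q S V (N - x))
            \<subseteq> lattice_points Q S (insert z V) N"
    proof (rule image_subsetI, clarify)
      fix x f assume x: "x \<in> D" and f: "f \<in> lattice_points Q S V (N - x)"
      have "sum (f(z := x)) V = sum f V" using assms by (intro sum.cong) auto
      with x f assms show "f(z := x) \<in> lattice_points Q S (insert z V) N"
        by (auto simp: lattice_points_def D_def PiE_def extensional_def)
    qed
  qed (use assms in \<open>auto simp: lattice_points_def PiE_def extensional_def fun_eq_iff\<close>)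
  then have "card (lattice_points Q S (insert z V) N) = card (Sigma D (\<lambda>x. lattice_points Q S V (N - x)))"
    by (rule bij_betw_same_card)
  also have "\<dots> = (\<Sum>x\<in>D. card (lattice_points Q S V (N - x)))"
    using \<open>finite D\<close> finite_lattice_points[OF \<open>finite V\<close>] by (intro card_SigmaI) auto
  finally show ?thesis by (simp add: D_def)
qed

text \<open>
  The probability that \<open>p\<close> divides all coordinates in \<open>T\<close>, for a uniformly chosen residue vector
  modulo \<open>p\<close> with coordinate sum \<open>N\<close>.  If \<open>T\<close> contains all coordinates, this is possible only for
  \<open>p dvd N\<close>, and the last condition is then implied by the others.
\<close>

definition local_density :: "'a set \<Rightarrow> nat \<Rightarrow> nat \<Rightarrow> 'a set \<Rightarrow> real" where
  "local_density V N p T =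
     (if V \<subseteq> T then if p dvd N then 1 / real p ^ (card V - 1) else 0
      else 1 / real p ^ card (V \<inter> T))"

lemma local_density_nonneg: "local_density V N p T \<ge> 0"
  by (simp add: local_density_def)

text \<open>
  The last element of \<open>zs\<close> is the coordinate that is placed first.  Stage \<open>j\<close> is the step at which
  \<open>zs ! j\<close> joins the coordinates \<open>drop (Suc j) zs\<close> placed before; the coordinates \<open>take j zs\<close>
  are still missing.  The error made at that step carries a factor \<open>p\<close> to the power minus the
  following exponent, where \<open>T\<close> is the set of coordinates that \<open>p\<close> has to divide: every condition
  on a coordinate of a later step saves a factor \<open>p\<close>, the conditions on the earlier coordinates are
  in the density of the problem solved so far, and the condition on \<open>zs ! j\<close> is lost.
\<close>

definition stage_exp :: "'a list \<Rightarrow> nat \<Rightarrow> 'a set \<Rightarrow> nat" where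
  "stage_exp zs j T = card (set (take j zs) \<inter> T)
      + min (card (set (drop (Suc j) zs) \<inter> T)) (length zs - j - 2)"

definition lattice_error :: "nat set \<Rightarrow> (nat \<Rightarrow> 'a set) \<Rightarrow> 'a list \<Rightarrow> real" where
  "lattice_error Q S zs = (\<Sum>j<length zs - 1. \<Prod>p\<in>Q. 1 / real p ^ stage_exp zs j (S p))"

lemma lattice_error_nonneg: "lattice_error Q S zs \<ge> 0"
  unfolding lattice_error_def by (intro sum_nonneg prod_nonneg) auto

lemma lattice_error_Cons:
  assumes "finite Q" "z \<notin> set zs" "zs \<noteq> []"
  shows "lattice_error Q S (z # zs) = lattice_error Q S zs / real (\<Prod>{p \<in> Q. z \<in> S p})
           + (\<Prod>p\<in>Q. 1 / real p ^ min (card (set zs \<inter> S p)) (length zs - 1))"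
proof -
  have exp_Suc: "stage_exp (z # zs) (Suc j) T = (if z \<in> T then 1 else 0) + stage_exp zs j T" for j T
  proof -
    have "z \<notin> set (take j zs)" using assms by (meson in_set_takeD)
    then show ?thesis by (simp add: stage_exp_def)
  qed
  have "(\<Prod>p\<in>Q. 1 / real p ^ (if z \<in> S p then 1 else 0)) = (\<Prod>p\<in>Q. if z \<in> S p then 1 / real p else 1)"
    by (intro prod.cong) auto
  also have "\<dots> = (\<Prod>p\<in>{p \<in> Q. z \<in> S p}. 1 / real p)"
    using assms by (simp add: prod.inter_filter)
  finally have c: "(\<Prod>p\<in>Q. 1 / real p ^ (if z \<in> S p then 1 else 0)) = 1 / real (\<Prod>{p \<in> Q. z \<in> S p})"
    by (simp add: prod_dividef)
  obtain l where l: "length zs = Suc l" using assms by (cases zs) auto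
  have "lattice_error Q S (z # zs) = (\<Sum>j<Suc l. \<Prod>p\<in>Q. 1 / real p ^ stage_exp (z # zs) j (S p))"
    by (simp add: lattice_error_def l)
  also have "\<dots> = (\<Prod>p\<in>Q. 1 / real p ^ stage_exp (z # zs) 0 (S p))
      + (\<Sum>j<l. \<Prod>p\<in>Q. 1 / real p ^ stage_exp (z # zs) (Suc j) (S p))"
    by (rule sum.lessThan_Suc_shift)
  also have "(\<Sum>j<l. \<Prod>p\<in>Q. 1 / real p ^ stage_exp (z # zs) (Suc j) (S p))
      = (\<Sum>j<l. (\<Prod>p\<in>Q. 1 / real p ^ (if z \<in> S p then 1 else 0)) * (\<Prod>p\<in>Q. 1 / real p ^ stage_exp zs j (S p)))"
    unfolding exp_Suc by (simp add: power_add flip: prod.distrib)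
  also have "\<dots> = lattice_error Q S zs / real (\<Prod>{p \<in> Q. z \<in> S p})"
    unfolding c lattice_error_def l by (simp add: sum_divide_distrib)
  finally show ?thesis by (simp add: stage_exp_def l)
qed

lemma card_multiples_below:
  fixes c N :: nat
  assumes "c > 0"
  shows "real (card {x. 0 < x \<and> x < N \<and> c dvd x}) \<le> real N / real c"
proof -
  have "{x. 0 < x \<and> x < N \<and> c dvd x} \<subseteq> (\<lambda>i. c * i) ` {1..N div c}"
  proof
    fix x assume "x \<in> {x. 0 < x \<and> x < N \<and> c dvd x}"
    then obtain i where "x = c * i" "0 < x" "x < N" by auto
    then show "x \<in> (\<lambda>i. c * i) ` {1..N div c}"
      using assms by (auto simp: less_eq_div_iff_mult_less_eq mult_ac)
  qed
  then have "card {x. 0 < x \<and> x < N \<and> c dvd x} \<le> card ((\<lambda>i. c * i) ` {1..N div c})"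
    by (intro card_mono) auto
  also have "\<dots> \<le> N div c" using card_image_le[of "{1..N div c}"] by simp
  finally have "real (card {x. 0 < x \<and> x < N \<and> c dvd x}) \<le> real (N div c)" by simp
  also have "\<dots> \<le> real N / real c" by (rule of_nat_div_le_of_nat)
  finally show ?thesis .
qed

lemma lattice_points_singleton:
  assumes "N > 0"
  shows "card (lattice_points Q S {z} N) = (if \<forall>p\<in>Q. z \<in> S p \<longrightarrow> p dvd N then 1 else 0)"
proof -
  have "lattice_points Q S {z} N = (if \<forall>p\<in>Q. z \<in> S p \<longrightarrow> p dvd N then {(\<lambda>i. undefined)(z := N)} else {})"
    using assms by (auto simp: lattice_points_def PiE_def extensional_def fun_eq_iff)
  then show ?thesis by simp
qed

text \<open>
  For a prime in both sets the two conditions on \<open>R\<close> are consistent because \<open>p\<close> divides \<open>N\<close>; the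
  rest is the Chinese remainder theorem.
\<close>

lemma simultaneous_congruences:
  fixes Q A B :: "nat set"
  assumes "finite Q" "\<And>p. p \<in> Q \<Longrightarrow> prime p" "A \<subseteq> Q" "B \<subseteq> Q" "\<And>p. p \<in> A \<inter> B \<Longrightarrow> p dvd N"
  obtains a where
    "\<And>R. R \<le> N \<Longrightarrow> (\<forall>p\<in>A. p dvd N - R) \<and> (\<forall>p\<in>B. p dvd R) \<longleftrightarrow> [R = a] (mod \<Prod>(A \<union> B))"
proof -
  have fin: "finite (A \<union> B)" using assms by (meson Un_least finite_subset)
  have pr: "prime p" if "p \<in> A \<union> B" for p using that assms by auto
  have cop: "\<forall>p\<in>A \<union> B. \<forall>q\<in>A \<union> B. p \<noteq> q \<longrightarrow> coprime p q"
    using pr primes_coprime_nat by blast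
  obtain a where a: "\<forall>p\<in>A \<union> B. [a = (if p \<in> B then 0 else N)] (mod p)"
    using chinese_remainder_nat[OF fin, of "\<lambda>p. p" "\<lambda>p. if p \<in> B then 0 else N"] cop by blast
  have step: "[R = a] (mod p) \<longleftrightarrow> (p \<in> A \<longrightarrow> p dvd N - R) \<and> (p \<in> B \<longrightarrow> p dvd R)"
    if "R \<le> N" "p \<in> A \<union> B" for R p
  proof (cases "p \<in> B")
    case True
    then have "[a = 0] (mod p)" using bspec[OF a that(2)] by simp
    then have "[R = a] (mod p) \<longleftrightarrow> p dvd R"
      by (metis cong_0_iff cong_sym cong_trans)
    moreover have "p dvd N - R" if "p dvd R" "p \<in> A"
      using assms(5) True that by auto
    ultimately show ?thesis using True by blast
  next
    case False
    then have "[a = N] (mod p)" "p \<in> A" using bspec[OF a that(2)] that by auto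
    then have "[R = a] (mod p) \<longleftrightarrow> [N = R] (mod p)"
      by (metis cong_sym cong_trans)
    also have "\<dots> \<longleftrightarrow> p dvd N - R" by (rule cong_altdef_nat) fact
    finally show ?thesis using False \<open>p \<in> A\<close> by simp
  qed
  have all: "[R = a] (mod \<Prod>(A \<union> B)) \<longleftrightarrow> (\<forall>p\<in>A \<union> B. [R = a] (mod p))" for R
  proof
    assume "[R = a] (mod \<Prod>(A \<union> B))"
    then show "\<forall>p\<in>A \<union> B. [R = a] (mod p)"
      using fin by (meson cong_dvd_modulus_nat dvd_prodI)
  next
    assume "\<forall>p\<in>A \<union> B. [R = a] (mod p)"
    then show "[R = a] (mod \<Prod>(A \<union> B))"
      using cop by (intro coprime_cong_prod_nat) auto
  qed
  show ?thesis
  proof (rule that)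
    fix R assume "R \<le> N"
    have "[R = a] (mod \<Prod>(A \<union> B))
        \<longleftrightarrow> (\<forall>p\<in>A \<union> B. (p \<in> A \<longrightarrow> p dvd N - R) \<and> (p \<in> B \<longrightarrow> p dvd R))"
      unfolding all by (intro ball_cong refl step[OF \<open>R \<le> N\<close>])
    then show "(\<forall>p\<in>A. p dvd N - R) \<and> (\<forall>p\<in>B. p dvd R) \<longleftrightarrow> [R = a] (mod \<Prod>(A \<union> B))"
      by blast
  qed
qed

text \<open>
  Induction along the list.  When a coordinate with value \<open>x\<close> is added, the previous error bound is
  used for each of the at most \<open>N / c\<close> admissible \<open>x\<close>, where \<open>c\<close> is the product of the primes
  that must divide \<open>x\<close>.  The previous main term is a power of \<open>R = N - x\<close> times a constant when
  \<open>R\<close> is divisible by the primes that divide all earlier coordinates, and 0 otherwise.  So it has to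
  be summed over the \<open>R\<close> in one residue class, which costs that constant times \<open>N ^ (m - 1)\<close>.  A
  single coordinate is counted without error.
\<close>

theorem card_lattice_points_asymptotic:
  fixes S :: "nat \<Rightarrow> 'a set"
  assumes Q: "finite Q" "\<And>p. p \<in> Q \<Longrightarrow> prime p"
    and "zs \<noteq> []" "distinct zs" "N > 0"
  shows "\<bar>real (card (lattice_points Q S (set zs) N))
           - real N ^ (length zs - 1) / fact (length zs - 1)
             * (\<Prod>p\<in>Q. local_density (set zs) N p (S p))\<bar>
         \<le> lattice_error Q S zs * real N ^ (length zs - 2)"
  using assms(3-)
proof (induction zs arbitrary: N rule: list_nonempty_induct)
  case (single z)
  have "(\<Prod>p\<in>Q. local_density {z} N p (S p)) = (if \<forall>p\<in>Q. z \<in> S p \<longrightarrow> p dvd N then 1 else 0)"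
  proof (cases "\<forall>p\<in>Q. z \<in> S p \<longrightarrow> p dvd N")
    case True
    then show ?thesis by (auto simp: local_density_def intro!: prod.neutral)
  next
    case False
    then show ?thesis using Q(1) by (auto simp: local_density_def prod_zero_iff)
  qed
  then show ?case using lattice_points_singleton[OF \<open>N > 0\<close>, of Q S z]
    by (simp add: lattice_error_def)
next
  case (cons z zs)
  define V where "V = set zs"
  define m where "m = length zs"
  define D where "D = {x. 0 < x \<and> x < N \<and> (\<forall>p\<in>Q. z \<in> S p \<longrightarrow> p dvd x)}"
  define c where "c = \<Prod>{p \<in> Q. z \<in> S p}"
  define L where "L = (\<lambda>R. real (card (lattice_points Q S V R)))"
  define M where "M = (\<lambda>R. real R ^ (m - 1) / fact (m - 1) * (\<Prod>p\<in>Q. local_density V R p (S p)))"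
  define kap where "kap = (\<Prod>p\<in>Q. 1 / real p ^ min (card (V \<inter> S p)) (m - 1))"
  have m: "m > 0" and z: "z \<notin> V" "distinct zs" using cons by (auto simp: m_def V_def)
  have V: "finite V" "V \<noteq> {}" "card V = m"
    using cons z by (auto simp: V_def m_def distinct_card)
  have pos: "p > 0" if "p \<in> Q" for p using Q that prime_gt_0_nat by blast
  have "c > 0" unfolding c_def by (intro prod_pos) (use pos in auto)
  have finD: "finite D" by (rule finite_subset[of _ "{..N}"]) (auto simp: D_def)
  have kap0: "kap \<ge> 0" unfolding kap_def by (intro prod_nonneg) auto
  have err0: "lattice_error Q S zs \<ge> 0" by (rule lattice_error_nonneg)

  have step1: "\<bar>(\<Sum>x\<in>D. L (N - x)) - (\<Sum>x\<in>D. M (N - x))\<bar> \<le> lattice_error Q S zs / real c * real N ^ (m - 1)"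
  proof -
    have "\<bar>(\<Sum>x\<in>D. L (N - x)) - (\<Sum>x\<in>D. M (N - x))\<bar> \<le> (\<Sum>x\<in>D. \<bar>L (N - x) - M (N - x)\<bar>)"
      unfolding sum_subtractf[symmetric] by (rule sum_abs)
    also have "\<dots> \<le> (\<Sum>x\<in>D. lattice_error Q S zs * real N ^ (m - 2))"
    proof (rule sum_mono)
      fix x assume x: "x \<in> D"
      have "\<bar>L (N - x) - M (N - x)\<bar> \<le> lattice_error Q S zs * real (N - x) ^ (m - 2)"
        using cons.IH[of "N - x"] z x by (auto simp: L_def M_def V_def m_def D_def)
      also have "\<dots> \<le> lattice_error Q S zs * real N ^ (m - 2)"
        by (intro mult_left_mono power_mono err0) auto
      finally show "\<bar>L (N - x) - M (N - x)\<bar> \<le> lattice_error Q S zs * real N ^ (m - 2)" .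
    qed
    also have "\<dots> = real (card D) * (lattice_error Q S zs * real N ^ (m - 2))" by simp
    also have "\<dots> \<le> real N / real c * (lattice_error Q S zs * real N ^ (m - 2))"
    proof (rule mult_right_mono)
      have "D = {x. 0 < x \<and> x < N \<and> c dvd x}"
        unfolding D_def c_def using Q by (subst primes_prod_dvd_iff) auto
      then show "real (card D) \<le> real N / real c" using card_multiples_below[OF \<open>c > 0\<close>] by simp
    qed (use err0 in auto)
    also have "\<dots> = lattice_error Q S zs / real c * real N ^ (m - 1)"
    proof (cases "m = 1")
      case True
      then have "lattice_error Q S zs = 0" by (simp add: lattice_error_def m_def)
      then show ?thesis by simp
    next
      case False
      then have "m - 1 = Suc (m - 2)" using m by simp
      then show ?thesis by simp
    qed
    finally show ?thesis .
  qed

  have densV: "(\<Prod>p\<in>Q. local_density V R p (S p)) = (if \<forall>p\<in>Q. V \<subseteq> S p \<longrightarrow> p dvd R then kap else 0)" for R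
  proof (cases "\<forall>p\<in>Q. V \<subseteq> S p \<longrightarrow> p dvd R")
    case True
    have "local_density V R p (S p) = 1 / real p ^ min (card (V \<inter> S p)) (m - 1)" if "p \<in> Q" for p
    proof (cases "V \<subseteq> S p")
      case sub: True
      then have "V \<inter> S p = V" by auto
      with sub True that show ?thesis by (simp add: local_density_def V)
    next
      case False
      then have "V \<inter> S p \<subset> V" by auto
      then have "card (V \<inter> S p) < m" using V psubset_card_mono by metis
      with False show ?thesis by (simp add: local_density_def min_def)
    qed
    with True show ?thesis by (simp add: kap_def)
  next
    case False
    then show ?thesis using Q(1) by (auto simp: local_density_def prod_zero_iff)
  qed

  \<comment> \<open>In terms of the remaining sum R, all conditions are divisibility conditions on R and N - R.\<close>
  define D'' where "D'' = {R. 0 < R \<and> R < N \<and> (\<forall>p\<in>{p\<in>Q. z \<in> S p}. p dvd N - R) \<and> (\<forall>p\<in>{p\<in>Q. V \<subseteq> S p}. p dvd R)}"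
  have "(\<Sum>x\<in>D. M (N - x)) = (\<Sum>R\<in>{R. 0 < R \<and> R < N \<and> (\<forall>p\<in>Q. z \<in> S p \<longrightarrow> p dvd N - R)}. M R)"
    by (rule sum.reindex_bij_witness[of _ "\<lambda>R. N - R" "\<lambda>x. N - x"]) (auto simp: D_def)
  also have "\<dots> = (\<Sum>R\<in>{R. 0 < R \<and> R < N \<and> (\<forall>p\<in>Q. z \<in> S p \<longrightarrow> p dvd N - R)}.
       if \<forall>p\<in>Q. V \<subseteq> S p \<longrightarrow> p dvd R then kap / fact (m - 1) * real R ^ (m - 1) else 0)"
    by (intro sum.cong) (auto simp: M_def densV)
  also have "\<dots> = (\<Sum>R\<in>D''. kap / fact (m - 1) * real R ^ (m - 1))"
    by (subst sum.inter_filter [symmetric])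
       (auto simp: D''_def intro!: sum.cong finite_subset[of _ "{..N}"])
  finally have sumM: "(\<Sum>x\<in>D. M (N - x)) = kap / fact (m - 1) * (\<Sum>R\<in>D''. real R ^ (m - 1))"
    by (simp add: sum_distrib_left)

  define M' where "M' = real N ^ m / fact m * (\<Prod>p\<in>Q. local_density (insert z V) N p (S p))"
  have step2: "\<bar>(\<Sum>x\<in>D. M (N - x)) - M'\<bar> \<le> kap * real N ^ (m - 1)"
  proof (cases "\<forall>p\<in>Q. z \<in> S p \<and> V \<subseteq> S p \<longrightarrow> p dvd N")
    case False
    then obtain p where p: "p \<in> Q" "z \<in> S p" "V \<subseteq> S p" "\<not> p dvd N" by auto
    have "R \<notin> D''" for R
    proof
      assume "R \<in> D''"
      then have "p dvd N - R" "p dvd R" "R \<le> N" using p by (auto simp: D''_def)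
      then have "p dvd N" by (rule dvd_diffD)
      with p show False by simp
    qed
    then have "D'' = {}" by blast
    moreover have "local_density (insert z V) N p (S p) = 0" using p by (simp add: local_density_def)
    then have "M' = 0" using p Q(1) by (auto simp: M'_def prod_zero_iff)
    ultimately show ?thesis using kap0 by (simp add: sumM)
  next
    case True
    define Q' where "Q' = {p\<in>Q. z \<in> S p} \<union> {p\<in>Q. V \<subseteq> S p}"
    obtain a where a: "\<And>R. R \<le> N \<Longrightarrow> (\<forall>p\<in>{p\<in>Q. z \<in> S p}. p dvd N - R) \<and> (\<forall>p\<in>{p\<in>Q. V \<subseteq> S p}. p dvd R)
        \<longleftrightarrow> [R = a] (mod \<Prod>Q')"
      unfolding Q'_def using True
      by (rule_tac simultaneous_congruences[OF Q, of "{p\<in>Q. z \<in> S p}" "{p\<in>Q. V \<subseteq> S p}" N]) blast+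
    have D'': "D'' = {R. 0 < R \<and> R < N \<and> [R = a] (mod \<Prod>Q')}"
      unfolding D''_def using a[OF less_imp_le] by (intro Collect_cong) blast
    have q: "\<Prod>Q' > 0" by (intro prod_pos) (use pos in \<open>auto simp: Q'_def\<close>)
    have AP: "\<bar>(\<Sum>R\<in>D''. real R ^ (m - 1)) - real N ^ m / (real m * real (\<Prod>Q'))\<bar> \<le> real N ^ (m - 1)"
      using power_sum_residue_class[OF q, where N = N and a = a and r = "m - 1"] m unfolding D'' by simp
    have "(\<Prod>p\<in>Q. local_density (insert z V) N p (S p)) = (\<Prod>p\<in>Q. 1 / real p ^ min (card (V \<inter> S p)) (m - 1) * (if p \<in> Q' then 1 / real p else 1))"
    proof (rule prod.cong)
      fix p assume p: "p \<in> Q"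
      consider "V \<subseteq> S p" "z \<in> S p" | "V \<subseteq> S p" "z \<notin> S p" | "\<not> V \<subseteq> S p" by blast
      then show "local_density (insert z V) N p (S p) = 1 / real p ^ min (card (V \<inter> S p)) (m - 1) * (if p \<in> Q' then 1 / real p else 1)"
      proof cases
        case 1
        then have "V \<inter> S p = V" by auto
        with 1 True p V z show ?thesis
          using m by (simp add: local_density_def Q'_def power_eq_if)
      next
        case 2
        then have "V \<inter> S p = V" "insert z V \<inter> S p = V" by auto
        moreover have "\<not> insert z V \<subseteq> S p" using 2 by simp
        ultimately show ?thesis using 2 p V m by (simp add: local_density_def Q'_def power_eq_if)
      next
        case 3
        then have "V \<inter> S p \<subset> V" by auto
        then have "card (V \<inter> S p) < m" using V psubset_card_mono by metis
        moreover have "card (insert z V \<inter> S p) = card (V \<inter> S p) + (if z \<in> S p then 1 else 0)"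
          using V z by (auto simp: Int_insert_left)
        ultimately show ?thesis using 3 p by (auto simp: local_density_def Q'_def min_def)
      qed
    qed auto
    also have "\<dots> = kap * (\<Prod>p\<in>Q'. 1 / real p)"
    proof -
      have "(\<Prod>p\<in>{p \<in> Q. p \<in> Q'}. 1 / real p) = (\<Prod>p\<in>Q. if p \<in> Q' then 1 / real p else 1)"
        by (rule prod.inter_filter[OF Q(1)])
      moreover have "{p \<in> Q. p \<in> Q'} = Q'" by (auto simp: Q'_def)
      ultimately have "(\<Prod>p\<in>Q'. 1 / real p) = (\<Prod>p\<in>Q. if p \<in> Q' then 1 / real p else 1)"
        by simp
      then show ?thesis unfolding kap_def prod.distrib by (simp only:)
    qed
    also have "(\<Prod>p\<in>Q'. 1 / real p) = 1 / real (\<Prod>Q')" by (simp add: prod_dividef)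
    finally have "M' = kap / fact (m - 1) * (real N ^ m / (real m * real (\<Prod>Q')))"
      using m by (simp add: M'_def fact_reduce[of m] mult_ac)
    then have "(\<Sum>x\<in>D. M (N - x)) - M'
        = kap / fact (m - 1) * ((\<Sum>R\<in>D''. real R ^ (m - 1)) - real N ^ m / (real m * real (\<Prod>Q')))"
      by (simp only: sumM right_diff_distrib)
    then have "\<bar>(\<Sum>x\<in>D. M (N - x)) - M'\<bar>
        = kap / fact (m - 1) * \<bar>(\<Sum>R\<in>D''. real R ^ (m - 1)) - real N ^ m / (real m * real (\<Prod>Q'))\<bar>"
      using kap0 by (simp add: abs_mult)
    also have "\<dots> \<le> kap / fact (m - 1) * real N ^ (m - 1)"
      using AP kap0 by (intro mult_left_mono) auto
    also have "\<dots> \<le> kap / 1 * real N ^ (m - 1)"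
      using kap0 by (intro mult_right_mono divide_left_mono) (auto simp: fact_ge_1)
    finally show ?thesis by simp
  qed

  have "real (card (lattice_points Q S (set (z # zs)) N)) = (\<Sum>x\<in>D. L (N - x))"
    using card_lattice_points_insert[OF V(1) z(1) V(2), of Q S N]
    by (simp add: D_def L_def V_def)
  moreover have "lattice_error Q S (z # zs) = lattice_error Q S zs / real c + kap"
    using lattice_error_Cons[OF Q(1), of z zs S] cons z by (simp add: c_def kap_def V_def m_def)
  moreover have "length (z # zs) - 1 = m" "length (z # zs) - 2 = m - 1" "set (z # zs) = insert z V"
    by (simp_all add: m_def V_def)
  moreover have "\<bar>(\<Sum>x\<in>D. L (N - x)) - M'\<bar> \<le> (lattice_error Q S zs / real c + kap) * real N ^ (m - 1)"
  proof -
    have tri: "\<bar>a - c\<bar> \<le> u + v" if "\<bar>a - b\<bar> \<le> u" "\<bar>b - c\<bar> \<le> v" for a b c u v :: real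
      using that by linarith
    show ?thesis unfolding distrib_right by (rule tri[OF step1 step2])
  qed
  ultimately show ?case unfolding M'_def by (simp only:)
qed

section \<open>Inclusion-exclusion over assignments of types\<close>

definition type_part :: "nat set \<Rightarrow> (nat \<Rightarrow> 'a set) \<Rightarrow> 'a set \<Rightarrow> nat" where
  "type_part Q S T = \<Prod>{p \<in> Q. S p = T}"

definition type_weight :: "'a set set \<Rightarrow> ('a set \<Rightarrow> real) \<Rightarrow> ('a set \<Rightarrow> nat) \<Rightarrow> real" where
  "type_weight TT e d = (\<Prod>T\<in>TT. real (d T) powr - e T)"

lemma type_weight_nonneg: "type_weight TT e d \<ge> 0"
  unfolding type_weight_def by (intro prod_nonneg) auto

lemma type_weight_restrict [simp]: "type_weight TT e (restrict d TT) = type_weight TT e d"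
  by (simp add: type_weight_def)

lemma type_part_pos:
  assumes "\<And>p. p \<in> Q \<Longrightarrow> prime p"
  shows "type_part Q S T > 0"
  unfolding type_part_def by (intro prod_pos) (use assms prime_gt_0_nat in auto)

lemma dvd_type_part_iff:
  assumes "finite Q" "\<And>p. p \<in> Q \<Longrightarrow> prime p" "p \<in> Q"
  shows "p dvd type_part Q S T \<longleftrightarrow> S p = T"
proof
  assume "p dvd type_part Q S T"
  then obtain q where q: "q \<in> {p \<in> Q. S p = T}" "p dvd q"
    unfolding type_part_def using assms prime_dvd_prod_iff[of "{p \<in> Q. S p = T}" p "\<lambda>p. p"] by auto
  then have "p = q" using assms primes_dvd_imp_eq by blast
  with q show "S p = T" by simp
next
  assume "S p = T"
  then show "p dvd type_part Q S T"
    unfolding type_part_def using assms by (intro dvd_prodI) auto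
qed

lemma inj_on_type_part:
  assumes "finite Q" "\<And>p. p \<in> Q \<Longrightarrow> prime p" "{} \<notin> TT"
  shows "inj_on (\<lambda>S. restrict (type_part Q S) TT) (Q \<rightarrow>\<^sub>E insert {} TT)"
proof (rule inj_onI)
  fix S S' assume S: "S \<in> Q \<rightarrow>\<^sub>E insert {} TT" "S' \<in> Q \<rightarrow>\<^sub>E insert {} TT"
    and eq: "restrict (type_part Q S) TT = restrict (type_part Q S') TT"
  have iff: "S p = T \<longleftrightarrow> S' p = T" if "p \<in> Q" "T \<in> TT" for p T
  proof -
    have "type_part Q S T = type_part Q S' T" using eq that by (metis restrict_apply')
    then show ?thesis using dvd_type_part_iff[OF assms(1,2) that(1)] by metis
  qed
  have "S p = S' p" if "p \<in> Q" for p
    using S iff[OF that] PiE_mem[OF _ that] by (metis insert_iff)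
  then show "S = S'" using S by (intro PiE_ext) auto
qed

text \<open>
  This translates a stage of the lattice point error, a product over primes, into a product of powers
  of the parts \<open>d T\<close>.
\<close>

lemma prod_over_types:
  fixes f :: "'a set \<Rightarrow> nat"
  assumes "finite Q" "\<And>p. p \<in> Q \<Longrightarrow> prime p" "finite TT" "{} \<notin> TT"
    and "S \<in> Q \<rightarrow>\<^sub>E insert {} TT" "f {} = 0"
  shows "(\<Prod>p\<in>Q. 1 / real p ^ f (S p)) = type_weight TT (\<lambda>T. real (f T)) (type_part Q S)"
proof -
  have "(\<Prod>p\<in>Q. 1 / real p ^ f (S p)) = (\<Prod>T\<in>insert {} TT. \<Prod>p | p \<in> Q \<and> S p = T. 1 / real p ^ f (S p))"
    by (rule prod.group [symmetric]) (use assms in auto)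
  also have "\<dots> = (\<Prod>T\<in>TT. \<Prod>p | p \<in> Q \<and> S p = T. 1 / real p ^ f T)"
    using assms by (auto intro!: prod.cong prod.neutral)
  also have "\<dots> = (\<Prod>T\<in>TT. real (type_part Q S T) powr - real (f T))"
  proof (rule prod.cong)
    fix T assume "T \<in> TT"
    have "(\<Prod>p | p \<in> Q \<and> S p = T. 1 / real p ^ f T) = 1 / real (type_part Q S T) ^ f T"
      by (simp add: type_part_def prod_dividef prod_power_distrib)
    also have "\<dots> = real (type_part Q S T) powr - real (f T)"
      using type_part_pos[OF assms(2), where S = S and T = T]
      by (simp add: powr_minus_divide powr_realpow)
    finally show "(\<Prod>p | p \<in> Q \<and> S p = T. 1 / real p ^ f T) = real (type_part Q S T) powr - real (f T)" .
  qed auto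
  finally show ?thesis by (simp add: type_weight_def)
qed

lemma sum_type_parts_le:
  fixes g :: "('a set \<Rightarrow> nat) \<Rightarrow> real"
  assumes "finite Q" "\<And>p. p \<in> Q \<Longrightarrow> prime p" "finite TT" "{} \<notin> TT" "finite D"
    and "A \<subseteq> Q \<rightarrow>\<^sub>E insert {} TT" "\<And>S T. S \<in> A \<Longrightarrow> T \<in> TT \<Longrightarrow> type_part Q S T \<in> D"
    and "\<And>d. d \<in> TT \<rightarrow>\<^sub>E D \<Longrightarrow> g d \<ge> 0"
  shows "(\<Sum>S\<in>A. g (restrict (type_part Q S) TT)) \<le> (\<Sum>d\<in>TT \<rightarrow>\<^sub>E D. g d)"
proof -
  have "inj_on (\<lambda>S. restrict (type_part Q S) TT) A"
    using inj_on_type_part[of Q TT] assms inj_on_subset by metis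
  then have "(\<Sum>S\<in>A. g (restrict (type_part Q S) TT)) = sum g ((\<lambda>S. restrict (type_part Q S) TT) ` A)"
    by (simp add: sum.reindex)
  also have "\<dots> \<le> (\<Sum>d\<in>TT \<rightarrow>\<^sub>E D. g d)"
    using assms by (intro sum_mono2 finite_PiE) auto
  finally show ?thesis .
qed

lemma sum_inverse_squares_tail:
  assumes "n > 0"
  shows "(\<Sum>d\<in>{n<..N}. 1 / real d ^ 2) \<le> 1 / real n"
proof (cases "n \<le> N")
  case True
  then have "(\<Sum>d\<in>{n<..N}. 1 / real d ^ 2) \<le> 1 / real n - 1 / real N"
  proof (induction N rule: dec_induct)
    case (step N)
    have "{n<..Suc N} = insert (Suc N) {n<..N}" using step by auto
    moreover have "1 / real (Suc N) ^ 2 \<le> 1 / real N - 1 / real (Suc N)"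
    proof -
      have "1 / real N - 1 / real (Suc N) = 1 / (real N * real (Suc N))"
        using step assms by (simp add: field_simps)
      then show ?thesis using step assms unfolding power2_eq_square
        by (auto intro!: divide_left_mono mult_right_mono)
    qed
    ultimately show ?case using step.IH by simp
  qed simp
  then show ?thesis by (smt (verit) of_nat_0_le_iff divide_nonneg_nonneg)
qed simp

lemma sum_inverse_squares_le_2: "(\<Sum>d\<in>{1..N}. 1 / real d ^ 2) \<le> 2"
proof (cases "N = 0")
  case False
  then have "{1..N} = insert 1 {1<..N}" by auto
  then show ?thesis using sum_inverse_squares_tail[of 1 N] by simp
qed simp

text \<open>
  Expanding the product over the primes gives one lattice point problem for each assignment \<open>S\<close>.

  If all parts \<open>type_part Q S T\<close> are at most \<open>n\<close>, the error is controlled by every order of the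
  coordinates; the function \<open>g\<close> stands for a bound that is extracted from all these orders together,
  which allows the choice of the order to depend on \<open>S\<close>.  If some part exceeds \<open>n\<close>, there are no
  lattice points, since that part would divide a positive coordinate that is at most \<open>n\<close>.  The main
  terms of these assignments are bounded by the product of the inverse squares of the parts, and the
  tail of the corresponding sum saves a factor \<open>n\<close>.
\<close>

theorem weighted_count_asymptotic:
  fixes V :: "'a set" and kappa :: "nat \<Rightarrow> 'a set \<Rightarrow> real" and g :: "('a set \<Rightarrow> nat) \<Rightarrow> real"
    and n :: nat
  defines "Q \<equiv> {p. prime p \<and> p \<le> n}"
  assumes V: "finite V" "card V \<ge> 3" and n: "n > 0"
    and TT: "TT \<subseteq> Pow V" "\<And>T. T \<in> TT \<Longrightarrow> card T \<ge> 2"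
    and kappa: "\<And>p T. p \<in> Q \<Longrightarrow> T \<in> insert {} TT \<Longrightarrow> \<bar>kappa p T\<bar> \<le> 1"
    and w: "\<And>x. x \<in> lattice_points {} S0 V n \<Longrightarrow>
          w x = (\<Prod>p\<in>Q. \<Sum>T\<in>insert {} TT. kappa p T * (if \<forall>i\<in>T. p dvd x i then 1 else 0))"
    and g: "\<And>d r. \<lbrakk>d \<in> TT \<rightarrow>\<^sub>E {1..n};
          \<And>zs. \<lbrakk>set zs = V; distinct zs\<rbrakk> \<Longrightarrow>
             r \<le> (\<Sum>j<card V - 1. type_weight TT (\<lambda>T. real (stage_exp zs j T)) d)\<rbrakk> \<Longrightarrow> r \<le> g d"
    and g0: "\<And>d. g d \<ge> 0"
  shows "\<bar>(\<Sum>x\<in>lattice_points {} S0 V n. w x)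
           - real n ^ (card V - 1) / fact (card V - 1)
             * (\<Prod>p\<in>Q. \<Sum>T\<in>insert {} TT. kappa p T * local_density V n p T)\<bar>
         \<le> real n ^ (card V - 2) * ((\<Sum>d\<in>TT \<rightarrow>\<^sub>E {1..n}. g d) + real (card TT) * 2 ^ card TT)"
proof -
  define k where "k = card V"
  define P where "P = lattice_points {} S0 V n"
  define SS where "SS = Q \<rightarrow>\<^sub>E insert {} TT"
  define L where "L = (\<lambda>S. real (card (lattice_points Q S V n)))"
  define M where "M = (\<lambda>S. real n ^ (k - 1) / fact (k - 1) * (\<Prod>p\<in>Q. local_density V n p (S p)))"
  have finQ: "finite Q" unfolding Q_def by (rule finite_subset[of _ "{..n}"]) auto
  have prQ: "prime p" if "p \<in> Q" for p using that by (simp add: Q_def)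
  have finTT: "finite TT" using TT V by (meson finite_Pow_iff finite_subset)
  have neTT: "{} \<notin> TT" using TT(2) by force
  have finP: "finite P" unfolding P_def by (rule finite_lattice_points) fact
  have finSS: "finite SS" unfolding SS_def using finQ finTT by (intro finite_PiE) auto
  have SV: "S p \<subseteq> V" if "S \<in> SS" "p \<in> Q" for S p
    using that TT PiE_mem[of S Q "\<lambda>_. insert {} TT" p] by (auto simp: SS_def)
  have sub: "lattice_points Q S V n = {x \<in> P. \<forall>p\<in>Q. \<forall>i\<in>S p. p dvd x i}" if "S \<in> SS" for S
  proof -
    have "V \<inter> S p = S p" if "p \<in> Q" for p using SV[OF \<open>S \<in> SS\<close> that] by blast
    then show ?thesis by (auto simp: P_def lattice_points_def)
  qed

  have "(\<Sum>x\<in>P. w x) = (\<Sum>x\<in>P. \<Sum>S\<in>SS. \<Prod>p\<in>Q. kappa p (S p) * (if \<forall>i\<in>S p. p dvd x i then 1 else 0))"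
    unfolding SS_def using finQ finTT w by (intro sum.cong) (auto simp: prod_sum_PiE P_def)
  also have "\<dots> = (\<Sum>S\<in>SS. \<Sum>x\<in>P. (\<Prod>p\<in>Q. kappa p (S p)) * (if \<forall>p\<in>Q. \<forall>i\<in>S p. p dvd x i then 1 else 0))"
  proof (subst sum.swap, intro sum.cong refl)
    fix S :: "nat \<Rightarrow> 'a set" and x :: "'a \<Rightarrow> nat"
    have "(\<Prod>p\<in>Q. if \<forall>i\<in>S p. p dvd x i then 1 else 0 :: real) = (if \<forall>p\<in>Q. \<forall>i\<in>S p. p dvd x i then 1 else 0)"
      using finQ by (auto simp: prod_zero_iff)
    then show "(\<Prod>p\<in>Q. kappa p (S p) * (if \<forall>i\<in>S p. p dvd x i then 1 else 0)) =
         (\<Prod>p\<in>Q. kappa p (S p)) * (if \<forall>p\<in>Q. \<forall>i\<in>S p. p dvd x i then 1 else 0)"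
      by (simp only: prod.distrib)
  qed
  also have "\<dots> = (\<Sum>S\<in>SS. (\<Prod>p\<in>Q. kappa p (S p)) * L S)"
  proof (intro sum.cong refl)
    fix S assume "S \<in> SS"
    have "(\<Sum>x\<in>P. if \<forall>p\<in>Q. \<forall>i\<in>S p. p dvd x i then 1 else 0 :: real) = L S"
      unfolding L_def sub[OF \<open>S \<in> SS\<close>] using finP by (simp add: sum.inter_filter [symmetric])
    then show "(\<Sum>x\<in>P. (\<Prod>p\<in>Q. kappa p (S p)) * (if \<forall>p\<in>Q. \<forall>i\<in>S p. p dvd x i then 1 else 0)) =
         (\<Prod>p\<in>Q. kappa p (S p)) * L S"
      by (simp only: sum_distrib_left [symmetric])
  qed
  finally have sumw: "(\<Sum>x\<in>P. w x) = (\<Sum>S\<in>SS. (\<Prod>p\<in>Q. kappa p (S p)) * L S)" .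
  have main: "real n ^ (k - 1) / fact (k - 1) * (\<Prod>p\<in>Q. \<Sum>T\<in>insert {} TT. kappa p T * local_density V n p T)
      = (\<Sum>S\<in>SS. (\<Prod>p\<in>Q. kappa p (S p)) * M S)"
    unfolding SS_def M_def using finQ finTT
    by (simp add: prod_sum_PiE prod.distrib sum_distrib_left mult_ac)
  have "\<bar>(\<Sum>x\<in>P. w x) - real n ^ (k - 1) / fact (k - 1)
             * (\<Prod>p\<in>Q. \<Sum>T\<in>insert {} TT. kappa p T * local_density V n p T)\<bar>
      = \<bar>\<Sum>S\<in>SS. (\<Prod>p\<in>Q. kappa p (S p)) * (L S - M S)\<bar>"
    unfolding sumw main by (simp add: sum_subtractf right_diff_distrib)
  also have "\<dots> \<le> (\<Sum>S\<in>SS. \<bar>(\<Prod>p\<in>Q. kappa p (S p)) * (L S - M S)\<bar>)" by (rule sum_abs)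
  also have "\<dots> \<le> (\<Sum>S\<in>SS. \<bar>L S - M S\<bar>)"
  proof (rule sum_mono)
    fix S assume "S \<in> SS"
    then have S: "S \<in> Q \<rightarrow>\<^sub>E insert {} TT" by (simp add: SS_def)
    have "\<bar>kappa p (S p)\<bar> \<le> 1" if "p \<in> Q" for p
      using kappa[OF that PiE_mem[OF S that]] .
    then have "\<bar>\<Prod>p\<in>Q. kappa p (S p)\<bar> \<le> 1"
      unfolding abs_prod by (simp add: prod_le_1)
    then show "\<bar>(\<Prod>p\<in>Q. kappa p (S p)) * (L S - M S)\<bar> \<le> \<bar>L S - M S\<bar>"
      by (simp add: abs_mult mult_left_le_one_le)
  qed
  also have "\<dots> = (\<Sum>S | S \<in> SS \<and> (\<forall>T\<in>TT. type_part Q S T \<le> n). \<bar>L S - M S\<bar>)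
                + (\<Sum>S | S \<in> SS \<and> \<not> (\<forall>T\<in>TT. type_part Q S T \<le> n). \<bar>L S - M S\<bar>)"
    using finSS by (subst sum.union_disjoint [symmetric]) (auto intro!: sum.cong)
  also have "\<dots> \<le> real n ^ (k - 2) * (\<Sum>d\<in>TT \<rightarrow>\<^sub>E {1..n}. g d)
                + real n ^ (k - 2) * (real (card TT) * 2 ^ card TT)"
  proof (rule add_mono)
    define A where "A = {S. S \<in> SS \<and> (\<forall>T\<in>TT. type_part Q S T \<le> n)}"
    have tp: "type_part Q S T \<in> {1..n}" if "S \<in> A" "T \<in> TT" for S T
      using that type_part_pos[OF prQ] by (auto simp: A_def Suc_le_eq)
    have "(\<Sum>S\<in>A. \<bar>L S - M S\<bar>) \<le> (\<Sum>S\<in>A. real n ^ (k - 2) * g (restrict (type_part Q S) TT))"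
    proof (rule sum_mono)
      fix S assume S: "S \<in> A"
      have "\<bar>L S - M S\<bar> / real n ^ (k - 2) \<le> g (restrict (type_part Q S) TT)"
      proof (rule g)
        show "restrict (type_part Q S) TT \<in> TT \<rightarrow>\<^sub>E {1..n}" using tp[OF S] by auto
        fix zs assume zs: "set zs = V" "distinct zs"
        then have len: "length zs = k" "zs \<noteq> []" using V distinct_card[of zs] by (auto simp: k_def)
        have "\<bar>L S - M S\<bar> \<le> lattice_error Q S zs * real n ^ (k - 2)"
          using card_lattice_points_asymptotic[OF finQ prQ len(2) zs(2) n, of S]
          unfolding L_def M_def zs(1) len(1) by simp
        moreover have "lattice_error Q S zs = (\<Sum>j<card V - 1. type_weight TT (\<lambda>T. real (stage_exp zs j T)) (type_part Q S))"
          unfolding lattice_error_def len k_def using S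
          by (intro sum.cong prod_over_types[OF finQ prQ finTT neTT])
             (auto simp: A_def SS_def stage_exp_def)
        ultimately show "\<bar>L S - M S\<bar> / real n ^ (k - 2)
            \<le> (\<Sum>j<card V - 1. type_weight TT (\<lambda>T. real (stage_exp zs j T)) (restrict (type_part Q S) TT))"
          using n by (simp add: divide_le_eq)
      qed
      then show "\<bar>L S - M S\<bar> \<le> real n ^ (k - 2) * g (restrict (type_part Q S) TT)"
        using n by (simp add: divide_le_eq mult_ac)
    qed
    also have "\<dots> = real n ^ (k - 2) * (\<Sum>S\<in>A. g (restrict (type_part Q S) TT))"
      by (simp add: sum_distrib_left)
    also have "\<dots> \<le> real n ^ (k - 2) * (\<Sum>d\<in>TT \<rightarrow>\<^sub>E {1..n}. g d)"
      using tp g0 by (intro mult_left_mono sum_type_parts_le finQ prQ finTT neTT) (auto simp: A_def SS_def)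
    finally show "(\<Sum>S | S \<in> SS \<and> (\<forall>T\<in>TT. type_part Q S T \<le> n). \<bar>L S - M S\<bar>)
        \<le> real n ^ (k - 2) * (\<Sum>d\<in>TT \<rightarrow>\<^sub>E {1..n}. g d)"
      by (simp add: A_def)
  next
    define B where "B = \<Prod>Q"
    define A where "A = {S. S \<in> SS \<and> \<not> (\<forall>T\<in>TT. type_part Q S T \<le> n)}"
    \<comment> \<open>The part at T0 exceeds n; inverse squares majorize the density because every type has two or more elements.\<close>
    define h where "h = (\<lambda>T0 d. \<Prod>T\<in>TT. if T = T0 \<and> d T \<le> n then 0 else 1 / real (d T) ^ 2)"
    have h0: "h T d \<ge> 0" for T d unfolding h_def by (intro prod_nonneg) auto
    have "B > 0" unfolding B_def by (intro prod_pos) (use prQ prime_gt_0_nat in auto)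
    have tp: "type_part Q S T \<in> {1..B}" for S T
    proof -
      have "type_part Q S T dvd B"
        unfolding type_part_def B_def using finQ by (intro prod_dvd_prod_subset) auto
      then have "type_part Q S T \<le> B" using \<open>B > 0\<close> by (rule dvd_imp_le)
      then show ?thesis using type_part_pos[OF prQ] by (auto simp: Suc_le_eq)
    qed
    have "(\<Sum>S\<in>A. \<bar>L S - M S\<bar>) \<le> (\<Sum>S\<in>A. real n ^ (k - 1) * (\<Sum>T0\<in>TT. h T0 (restrict (type_part Q S) TT)))"
    proof (rule sum_mono)
      fix S assume S: "S \<in> A"
      then obtain T0 where T0: "T0 \<in> TT" "type_part Q S T0 > n" by (auto simp: A_def not_le)
      have SS: "S \<in> SS" using S by (simp add: A_def)
      have "lattice_points Q S V n = {}"
      proof (rule ccontr)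
        assume "lattice_points Q S V n \<noteq> {}"
        then obtain x where x: "x \<in> lattice_points Q S V n" by auto
        obtain i where i: "i \<in> T0" using T0 neTT by (metis all_not_in_conv)
        then have "i \<in> V" using T0 TT by auto
        have "type_part Q S T0 dvd x i"
          unfolding type_part_def using finQ prQ x i \<open>i \<in> V\<close>
          by (subst primes_prod_dvd_iff) (auto simp: lattice_points_def)
        moreover have "x i > 0" "x i \<le> n"
          using x \<open>i \<in> V\<close> member_le_sum[of i V x] V by (auto simp: lattice_points_def PiE_iff Suc_le_eq)
        ultimately have "type_part Q S T0 \<le> n" using dvd_imp_le le_trans by blast
        then show False using T0 by simp
      qed
      moreover have "M S \<ge> 0"
        unfolding M_def by (intro mult_nonneg_nonneg prod_nonneg) (auto simp: local_density_nonneg)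
      ultimately have "\<bar>L S - M S\<bar> = M S" by (simp add: L_def)
      also have "M S \<le> real n ^ (k - 1) / 1 * (\<Prod>p\<in>Q. 1 / real p ^ (if S p = {} then 0 else 2))"
        unfolding M_def
      proof (intro mult_mono divide_left_mono prod_mono conjI prod_nonneg)
        fix p assume p: "p \<in> Q"
        then have p1: "p > 1" using prQ prime_gt_1_nat by blast
        show "local_density V n p (S p) \<le> 1 / real p ^ (if S p = {} then 0 else 2)"
        proof (cases "S p = {}")
          case True
          then show ?thesis using V by (auto simp: local_density_def)
        next
          case False
          then have "S p \<in> TT" using SS p by (auto simp: SS_def)
          then have "card (S p) \<ge> 2" "S p \<subseteq> V" using TT by auto
          then have "card (V \<inter> S p) \<ge> 2" by (simp add: Int_absorb1)
          then have "1 / real p ^ card (V \<inter> S p) \<le> 1 / real p ^ 2"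
            "1 / real p ^ (card V - 1) \<le> 1 / real p ^ 2"
            using p1 V by (intro divide_left_mono power_increasing; simp)+
          then show ?thesis using False by (simp add: local_density_def)
        qed
      qed (auto simp: fact_ge_1 local_density_nonneg)
      also have "(\<Prod>p\<in>Q. 1 / real p ^ (if S p = {} then 0 else 2))
          = type_weight TT (\<lambda>T. real (if T = {} then 0 else 2)) (type_part Q S)"
        using SS by (intro prod_over_types[OF finQ prQ finTT neTT, where f = "\<lambda>T. if T = {} then 0 else 2"]) (auto simp: SS_def)
      also have "\<dots> = h T0 (restrict (type_part Q S) TT)"
      proof -
        have "real (type_part Q S T) powr - real (if T = {} then 0 else 2)
           = (if T = T0 \<and> type_part Q S T \<le> n then 0 else 1 / real (type_part Q S T) ^ 2)"
          if "T \<in> TT" for T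
          using that T0 neTT type_part_pos[OF prQ, where S = S and T = T] by (auto simp: powr_minus_divide powr_realpow)
        then show ?thesis unfolding type_weight_def h_def by (intro prod.cong) auto
      qed
      also have "\<dots> \<le> (\<Sum>T0\<in>TT. h T0 (restrict (type_part Q S) TT))"
        using T0 finTT h0 by (intro member_le_sum) auto
      finally show "\<bar>L S - M S\<bar> \<le> real n ^ (k - 1) * (\<Sum>T0\<in>TT. h T0 (restrict (type_part Q S) TT))"
        by (simp add: mult_left_mono)
    qed
    also have "\<dots> = real n ^ (k - 1) * (\<Sum>S\<in>A. \<Sum>T0\<in>TT. h T0 (restrict (type_part Q S) TT))"
      by (simp add: sum_distrib_left)
    also have "\<dots> \<le> real n ^ (k - 1) * (\<Sum>d\<in>TT \<rightarrow>\<^sub>E {1..B}. \<Sum>T0\<in>TT. h T0 d)"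
      using tp h0 by (intro mult_left_mono sum_type_parts_le finQ prQ finTT neTT sum_nonneg) (auto simp: A_def SS_def)
    also have "(\<Sum>d\<in>TT \<rightarrow>\<^sub>E {1..B}. \<Sum>T0\<in>TT. h T0 d) = (\<Sum>T0\<in>TT. \<Sum>d\<in>TT \<rightarrow>\<^sub>E {1..B}. h T0 d)"
      by (rule sum.swap)
    also have "\<dots> \<le> (\<Sum>T0\<in>TT. 2 ^ card TT / real n)"
    proof (rule sum_mono)
      fix T0 assume T0: "T0 \<in> TT"
      have "(\<Sum>d\<in>TT \<rightarrow>\<^sub>E {1..B}. h T0 d)
          = (\<Prod>T\<in>TT. \<Sum>d\<in>{1..B}. if T = T0 \<and> d \<le> n then 0 else 1 / real d ^ 2)"
        unfolding h_def using finTT by (subst prod_sum_PiE) auto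
      also have "\<dots> = (\<Sum>d\<in>{1..B}. if d \<le> n then 0 else 1 / real d ^ 2) * (\<Prod>T\<in>TT - {T0}. \<Sum>d\<in>{1..B}. 1 / real d ^ 2)"
        using finTT T0 by (subst prod.remove[of _ T0]) auto
      also have "\<dots> \<le> 1 / real n * (\<Prod>T\<in>TT - {T0}. 2)"
      proof (intro mult_mono prod_mono conjI sum_inverse_squares_le_2 prod_nonneg sum_nonneg)
        have "(\<Sum>d\<in>{1..B}. if d \<le> n then 0 else 1 / real d ^ 2) = (\<Sum>d\<in>{n<..B}. 1 / real d ^ 2)"
          by (rule sum.mono_neutral_cong_right) auto
        then show "(\<Sum>d\<in>{1..B}. if d \<le> n then 0 else 1 / real d ^ 2) \<le> 1 / real n"
          using sum_inverse_squares_tail[OF n] by simp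
      qed auto
      also have "\<dots> \<le> 1 / real n * 2 ^ card TT"
        using finTT by (intro mult_left_mono) (auto intro!: power_increasing card_mono)
      finally show "(\<Sum>d\<in>TT \<rightarrow>\<^sub>E {1..B}. h T0 d) \<le> 2 ^ card TT / real n" by simp
    qed
    also have "real n ^ (k - 1) * (\<Sum>T0\<in>TT. 2 ^ card TT / real n) = real n ^ (k - 2) * (real (card TT) * 2 ^ card TT)"
    proof -
      have "k - 1 = Suc (k - 2)" using V by (simp add: k_def)
      then show ?thesis using n by simp
    qed
    finally show "(\<Sum>S | S \<in> SS \<and> \<not> (\<forall>T\<in>TT. type_part Q S T \<le> n). \<bar>L S - M S\<bar>)
        \<le> real n ^ (k - 2) * (real (card TT) * 2 ^ card TT)"
      by (simp add: A_def mult_left_mono)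
  qed
  finally show ?thesis by (simp add: P_def k_def distrib_left)
qed

section \<open>Sums of type weights\<close>

lemma harmonic_sum_le:
  assumes "n > 0"
  shows "(\<Sum>d\<in>{1..n}. 1 / real d) \<le> 1 + ln (real n)"
proof -
  have "harm n - ln (real n) \<le> harm 1 - ln (real 1)"
    using euler_mascheroni_sequence_decreasing[of 1 n] assms by simp
  then show ?thesis by (simp add: harm_def field_simps)
qed

lemma powr_sums_bounded:
  obtains K :: real where "K \<ge> 1"
    and "\<And>n e. e \<ge> 5 / 4 \<Longrightarrow> (\<Sum>d\<in>{1..n}. real d powr - e) \<le> K"
proof -
  define K where "K = max 1 (\<Sum>d. real d powr - (5 / 4))"
  have sm: "summable (\<lambda>d. real d powr - (5 / 4))" by (simp add: summable_real_powr_iff)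
  have "(\<Sum>d\<in>{1..n}. real d powr - e) \<le> K" if "e \<ge> 5 / 4" for n and e :: real
  proof -
    have "(\<Sum>d\<in>{1..n}. real d powr - e) \<le> (\<Sum>d\<in>{1..n}. real d powr - (5 / 4))"
      using that by (intro sum_mono powr_mono) auto
    also have "\<dots> \<le> (\<Sum>d. real d powr - (5 / 4))"
      by (intro sum_le_suminf sm) auto
    finally show ?thesis by (simp add: K_def)
  qed
  moreover have "K \<ge> 1" by (simp add: K_def)
  ultimately show ?thesis using that by blast
qed

lemma sum_type_weight_le:
  assumes "finite TT" "n > 0" "K \<ge> 1"
    and K: "\<And>n e. e \<ge> 5 / 4 \<Longrightarrow> (\<Sum>d\<in>{1..n}. real d powr - e) \<le> K"
    and e: "\<And>T. T \<in> TT \<Longrightarrow> e T \<ge> 1"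
    and M: "card {T \<in> TT. e T < 5 / 4} \<le> M"
  shows "(\<Sum>d\<in>TT \<rightarrow>\<^sub>E {1..n}. type_weight TT e d) \<le> K ^ card TT * (1 + ln (real n)) ^ M"
proof -
  define l where "l = 1 + ln (real n)"
  have l: "l \<ge> 1" using assms by (simp add: l_def)
  have "(\<Sum>d\<in>TT \<rightarrow>\<^sub>E {1..n}. type_weight TT e d) = (\<Prod>T\<in>TT. \<Sum>d\<in>{1..n}. real d powr - e T)"
    unfolding type_weight_def using assms by (subst prod_sum_PiE) auto
  also have "\<dots> \<le> (\<Prod>T\<in>TT. K * (if e T < 5 / 4 then l else 1))"
  proof (intro prod_mono conjI sum_nonneg)
    fix T assume T: "T \<in> TT"
    show "(\<Sum>d\<in>{1..n}. real d powr - e T) \<le> K * (if e T < 5 / 4 then l else 1)"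
    proof (cases "e T < 5 / 4")
      case True
      have "(\<Sum>d\<in>{1..n}. real d powr - e T) \<le> (\<Sum>d\<in>{1..n}. real d powr - 1)"
        using e[OF T] by (intro sum_mono powr_mono) auto
      also have "\<dots> = (\<Sum>d\<in>{1..n}. 1 / real d)"
        by (intro sum.cong) (auto simp: powr_minus_divide)
      also have "\<dots> \<le> 1 * l" using harmonic_sum_le[OF \<open>n > 0\<close>] by (simp add: l_def)
      also have "\<dots> \<le> K * l" using l \<open>K \<ge> 1\<close> by (intro mult_right_mono) auto
      finally show ?thesis using True by simp
    qed (use K in auto)
  qed auto
  also have "\<dots> = K ^ card TT * (\<Prod>T\<in>TT. if e T < 5 / 4 then l else 1)"
    by (simp add: prod.distrib)
  also have "(\<Prod>T\<in>TT. if e T < 5 / 4 then l else 1) = l ^ card {T \<in> TT. e T < 5 / 4}"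
    using assms(1) by (subst prod.inter_filter [symmetric]) auto
  also have "K ^ card TT * l ^ card {T \<in> TT. e T < 5 / 4} \<le> K ^ card TT * l ^ M"
    using M l \<open>K \<ge> 1\<close> by (intro mult_left_mono power_increasing) auto
  finally show ?thesis by (simp add: l_def)
qed

lemma sum_PiE_insert:
  assumes "P \<notin> A" "finite A" "finite D"
  shows "(\<Sum>d\<in>insert P A \<rightarrow>\<^sub>E D. F d) = (\<Sum>d\<in>A \<rightarrow>\<^sub>E D. \<Sum>a\<in>D. F (d(P := a)))"
proof -
  have "(\<Sum>d\<in>insert P A \<rightarrow>\<^sub>E D. F d) = (\<Sum>(a, d)\<in>D \<times> (A \<rightarrow>\<^sub>E D). F (d(P := a)))"
    unfolding PiE_insert_eq using inj_combinator[OF assms(1)]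
    by (subst sum.reindex) (auto simp: case_prod_unfold)
  also have "\<dots> = (\<Sum>a\<in>D. \<Sum>d\<in>A \<rightarrow>\<^sub>E D. F (d(P := a)))"
    by (simp add: sum.cartesian_product)
  also have "\<dots> = (\<Sum>d\<in>A \<rightarrow>\<^sub>E D. \<Sum>a\<in>D. F (d(P := a)))"
    by (rule sum.swap)
  finally show ?thesis .
qed

text \<open>
  With \<open>u\<close> and \<open>v\<close> the fourth roots of \<open>b + 1\<close> and \<open>b\<close>, the increment on the right is
  \<open>4 * (u - v)\<close>, and \<open>1 = u ^ 4 - v ^ 4 \<le> 4 * (u - v) * u ^ 3\<close>.
\<close>

lemma sum_powr_three_quarters_le: "(\<Sum>a\<in>{1..b}. real a powr - (3 / 4)) \<le> 4 * real b powr (1 / 4)"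
proof (induction b)
  case (Suc b)
  define u where "u = real (Suc b) powr (1 / 4)"
  define v where "v = real b powr (1 / 4)"
  have u: "u > 0" "u ^ 4 = real (Suc b)" "u ^ 3 = real (Suc b) powr (3 / 4)"
    by (auto simp: u_def powr_powr simp flip: powr_realpow)
  have v: "v \<ge> 0" "v ^ 4 = real b"
    by (cases "b = 0"; auto simp: v_def powr_powr simp flip: powr_realpow)+
  have "v \<le> u" unfolding u_def v_def by (intro powr_mono2) auto
  have "1 = u ^ 4 - v ^ 4" by (simp add: u v)
  also have "\<dots> = (u - v) * (u ^ 3 + u ^ 2 * v + u * v ^ 2 + v ^ 3)"
    by (simp add: algebra_simps power4_eq_xxxx power3_eq_cube power2_eq_square)
  also have "\<dots> \<le> (u - v) * (u ^ 3 + u ^ 2 * u + u * u ^ 2 + u ^ 3)"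
    using \<open>v \<le> u\<close> u v by (intro mult_left_mono add_mono mult_mono power_mono) auto
  also have "\<dots> = 4 * (u - v) * u ^ 3" by (simp add: algebra_simps power3_eq_cube power2_eq_square)
  finally have "1 / u ^ 3 \<le> 4 * (u - v)" using u by (simp add: divide_le_eq)
  moreover have "real (Suc b) powr - (3 / 4) = 1 / u ^ 3"
    unfolding u by (rule powr_minus_divide)
  ultimately show ?case using Suc.IH by (simp add: u_def v_def)
qed simp

text \<open>
  Summing the smaller of two parts, at exponent 3/4, raises the larger one to the power 1/4.  This
  implements the damping by a ratio of parts: the exponents 3/4 and 5/4 become a single
  exponent 1.
\<close>

lemma sum_eliminate_smaller_part:
  assumes "finite A" "P \<notin> A" "P' \<in> A" "e P = 3 / 4"
    and h: "\<And>d a. h (d(P := a)) = h d" "\<And>d. h d \<ge> 0"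
  shows "(\<Sum>d\<in>insert P A \<rightarrow>\<^sub>E {1..n}. if d P \<le> d P' then h d * type_weight (insert P A) e d else 0)
           \<le> 4 * (\<Sum>d\<in>A \<rightarrow>\<^sub>E {1..n}. h d * type_weight A (e(P' := e P' - 1 / 4)) d)"
proof -
  have "P \<noteq> P'" using assms by auto
  have tw: "type_weight (insert P A) e (d(P := a)) = real a powr - (3 / 4) * type_weight A e d" for d a
  proof -
    have "type_weight A e (d(P := a)) = type_weight A e d"
      unfolding type_weight_def using \<open>P \<notin> A\<close> by (intro prod.cong) auto
    then have "type_weight (insert P A) e (d(P := a)) = real a powr - e P * type_weight A e d"
      using assms(1,2) by (simp add: type_weight_def)
    then show ?thesis by (simp only: \<open>e P = 3 / 4\<close>)
  qed
  have "(\<Sum>d\<in>insert P A \<rightarrow>\<^sub>E {1..n}. if d P \<le> d P' then h d * type_weight (insert P A) e d else 0)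
      = (\<Sum>d\<in>A \<rightarrow>\<^sub>E {1..n}. \<Sum>a\<in>{1..n}. if a \<le> d P' then h d * (real a powr - (3 / 4) * type_weight A e d) else 0)"
    using assms(1,2) \<open>P \<noteq> P'\<close> \<open>P \<noteq> P'\<close>[symmetric]
    by (subst sum_PiE_insert) (simp_all only: h tw fun_upd_same fun_upd_other finite_atLeastAtMost if_False if_True not_False_eq_True)
  also have "\<dots> \<le> (\<Sum>d\<in>A \<rightarrow>\<^sub>E {1..n}. 4 * (h d * type_weight A (e(P' := e P' - 1 / 4)) d))"
  proof (rule sum_mono)
    fix d assume d: "d \<in> A \<rightarrow>\<^sub>E {1..n}"
    then have dP: "1 \<le> d P'" "d P' \<le> n" using \<open>P' \<in> A\<close> by auto
    have "(\<Sum>a\<in>{1..n}. if a \<le> d P' then h d * (real a powr - (3 / 4) * type_weight A e d) else 0)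
        = (\<Sum>a\<in>{1..d P'}. h d * (real a powr - (3 / 4) * type_weight A e d))"
      using dP by (intro sum.mono_neutral_cong_right) auto
    also have "\<dots> = h d * type_weight A e d * (\<Sum>a\<in>{1..d P'}. real a powr - (3 / 4))"
      by (simp add: sum_distrib_left mult_ac)
    also have "\<dots> \<le> h d * type_weight A e d * (4 * real (d P') powr (1 / 4))"
      by (intro mult_left_mono sum_powr_three_quarters_le mult_nonneg_nonneg h type_weight_nonneg)
    also have "type_weight A e d * real (d P') powr (1 / 4) = type_weight A (e(P' := e P' - 1 / 4)) d"
    proof -
      have "type_weight A e d = real (d P') powr - e P' * (\<Prod>T\<in>A - {P'}. real (d T) powr - e T)"
        unfolding type_weight_def using assms by (subst prod.remove[of _ P']) auto
      moreover have "type_weight A (e(P' := e P' - 1 / 4)) d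
          = real (d P') powr - (e P' - 1 / 4) * (\<Prod>T\<in>A - {P'}. real (d T) powr - e T)"
        unfolding type_weight_def using assms by (subst prod.remove[of _ P']) (auto intro!: prod.cong)
      moreover have "real (d P') powr - e P' * real (d P') powr (1 / 4) = real (d P') powr - (e P' - 1 / 4)"
        by (simp flip: powr_add)
      ultimately show ?thesis by (simp add: mult_ac)
    qed
    then have "h d * type_weight A e d * (4 * real (d P') powr (1 / 4))
        = 4 * (h d * type_weight A (e(P' := e P' - 1 / 4)) d)" by (simp add: mult_ac)
    finally show "(\<Sum>a\<in>{1..n}. if a \<le> d P' then h d * (real a powr - (3 / 4) * type_weight A e d) else 0)
        \<le> 4 * (h d * type_weight A (e(P' := e P' - 1 / 4)) d)" .
  qed
  finally show ?thesis by (simp add: sum_distrib_left)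
qed

lemma sum_two_ordered_pairs_le:
  assumes "finite TT" "n > 0" "K \<ge> 1"
    and K: "\<And>n e. e \<ge> 5 / 4 \<Longrightarrow> (\<Sum>d\<in>{1..n}. real d powr - e) \<le> K"
    and TT: "P \<in> TT" "P' \<in> TT" "R \<in> TT" "R' \<in> TT" "distinct [P, P', R, R']"
    and e: "e P = 3 / 4" "e P' = 5 / 4" "e R = 3 / 4" "e R' = 5 / 4"
      "\<And>T. T \<in> TT \<Longrightarrow> T \<notin> {P, R} \<Longrightarrow> e T \<ge> 5 / 4"
  shows "(\<Sum>d\<in>TT \<rightarrow>\<^sub>E {1..n}. if d P \<le> d P' \<and> d R \<le> d R' then type_weight TT e d else 0)
           \<le> 16 * K ^ card TT * (1 + ln (real n)) ^ 2"
proof -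
  define A where "A = TT - {P}"
  define B where "B = A - {R}"
  define e1 where "e1 = e(P' := e P' - 1 / 4)"
  define e2 where "e2 = e1(R' := e1 R' - 1 / 4)"
  have A: "TT = insert P A" "P \<notin> A" "finite A" "P' \<in> A" "R \<in> A" "R' \<in> A" using assms by (auto simp: A_def)
  have B: "A = insert R B" "R \<notin> B" "finite B" "P' \<in> B" "R' \<in> B" using A TT by (auto simp: B_def)
  have "(\<Sum>d\<in>TT \<rightarrow>\<^sub>E {1..n}. if d P \<le> d P' \<and> d R \<le> d R' then type_weight TT e d else 0)
     = (\<Sum>d\<in>insert P A \<rightarrow>\<^sub>E {1..n}. if d P \<le> d P'
          then (if d R \<le> d R' then 1 else 0) * type_weight (insert P A) e d else 0)"
    unfolding A(1)[symmetric] by (intro sum.cong) auto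
  also have "\<dots> \<le> 4 * (\<Sum>d\<in>A \<rightarrow>\<^sub>E {1..n}. (if d R \<le> d R' then 1 else 0) * type_weight A e1 d)"
    unfolding e1_def using TT A e by (intro sum_eliminate_smaller_part) auto
  also have "(\<Sum>d\<in>A \<rightarrow>\<^sub>E {1..n}. (if d R \<le> d R' then 1 else 0) * type_weight A e1 d)
     = (\<Sum>d\<in>insert R B \<rightarrow>\<^sub>E {1..n}. if d R \<le> d R' then 1 * type_weight (insert R B) e1 d else 0)"
    unfolding B(1)[symmetric] by (intro sum.cong) auto
  also have "\<dots> \<le> 4 * (\<Sum>d\<in>B \<rightarrow>\<^sub>E {1..n}. 1 * type_weight B e2 d)"
    unfolding e2_def using TT B e by (intro sum_eliminate_smaller_part) (auto simp: e1_def)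
  also have "(\<Sum>d\<in>B \<rightarrow>\<^sub>E {1..n}. 1 * type_weight B e2 d) \<le> K ^ card B * (1 + ln (real n)) ^ 2"
    unfolding mult_1
  proof (rule sum_type_weight_le[OF B(3) \<open>n > 0\<close> \<open>K \<ge> 1\<close> K])
    have e2: "T \<in> {P', R'} \<or> e2 T \<ge> 5 / 4" if "T \<in> B" for T
      using that e(5)[of T] A B by (auto simp: e2_def e1_def)
    have "e2 P' = 1" "e2 R' = 1" using TT(5) e(2,4) by (auto simp: e2_def e1_def)
    then show "e2 T \<ge> 1" if "T \<in> B" for T using e2[OF that] by auto
    have "{T \<in> B. e2 T < 5 / 4} \<subseteq> {P', R'}"
    proof
      fix T assume "T \<in> {T \<in> B. e2 T < 5 / 4}"
      then have "T \<in> B" "\<not> 5 / 4 \<le> e2 T" by simp_all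
      then show "T \<in> {P', R'}" using e2 by blast
    qed
    then have "card {T \<in> B. e2 T < 5 / 4} \<le> card {P', R'}" by (intro card_mono) auto
    also have "\<dots> \<le> 2" using card_insert_le_m1[of 2 "{R'}" P'] by simp
    finally show "card {T \<in> B. e2 T < 5 / 4} \<le> 2" .
  qed
  also have "K ^ card B \<le> K ^ card TT"
    using assms(1,3) A B by (intro power_increasing card_mono) auto
  finally show ?thesis by (simp add: mult_right_mono)
qed

text \<open>
  A quantity below two weights is below their weighted geometric mean, and the geometric mean
  interpolates the exponents linearly.
\<close>

lemma type_weight_interpolate:
  assumes "\<And>T. T \<in> TT \<Longrightarrow> d T > 0" and "finite TT" and u: "0 \<le> u" "u \<le> 1"
    and r: "r \<le> type_weight TT e d" "r \<le> type_weight TT e' d"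
  shows "r \<le> type_weight TT (\<lambda>T. u * e T + (1 - u) * e' T) d"
proof (cases "r > 0")
  case True
  have pos: "type_weight TT e d > 0" for e
    unfolding type_weight_def by (intro prod_pos) (use assms in fastforce)
  have pw: "type_weight TT e d powr v = type_weight TT (\<lambda>T. v * e T) d" for e v
    unfolding type_weight_def by (simp add: prod_powr_distrib powr_powr mult_ac)
  have "r = r powr u * r powr (1 - u)" using True by (simp flip: powr_add)
  also have "\<dots> \<le> type_weight TT e d powr u * type_weight TT e' d powr (1 - u)"
    using True u r by (intro mult_mono powr_mono2) auto
  also have "\<dots> = type_weight TT (\<lambda>T. u * e T + (1 - u) * e' T) d"
    unfolding pw
    unfolding type_weight_def prod.distrib[symmetric] powr_add[symmetric]
    by (simp add: algebra_simps)
  finally show ?thesis .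
next
  case False
  then show ?thesis using type_weight_nonneg order_trans not_less by metis
qed

section \<open>One group is a single coordinate\<close>

definition straddling :: "'a set \<Rightarrow> 'a set \<Rightarrow> 'a set set" where
  "straddling X Y = {T. T \<subseteq> X \<union> Y \<and> T \<inter> X \<noteq> {} \<and> T \<inter> Y \<noteq> {}}"

text \<open>
  The function \<open>g\<close> bounds every quantity that is bounded by the sum of all stage weights for each
  order of \<open>V\<close>.  In total it may grow only like a power of the logarithm.
\<close>

definition total_error_bounded :: "'a set \<Rightarrow> 'a set set \<Rightarrow> nat \<Rightarrow> bool" where
  "total_error_bounded V TT M \<longleftrightarrow> (\<exists>C g. (\<forall>d. 0 \<le> g d) \<and>
     (\<forall>d r. (\<forall>T\<in>TT. d T > 0) \<longrightarrow>
        (\<forall>zs. set zs = V \<longrightarrow> distinct zs \<longrightarrow>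
           r \<le> (\<Sum>j<card V - 1. type_weight TT (\<lambda>T. real (stage_exp zs j T)) d)) \<longrightarrow> r \<le> g d) \<and>
     (\<forall>n>0. (\<Sum>d\<in>TT \<rightarrow>\<^sub>E {1..n}. g d) \<le> C * (1 + ln (real n)) ^ M))"

lemma straddling_commute: "straddling X Y = straddling Y X"
  by (auto simp: straddling_def)

lemma straddling_card_ge_2:
  assumes "finite X" "finite Y" "X \<inter> Y = {}" "T \<in> straddling X Y"
  shows "finite T" "card T \<ge> 2"
proof -
  show "finite T" using assms by (auto simp: straddling_def intro: finite_subset)
  obtain x y where "x \<in> T" "x \<in> X" "y \<in> T" "y \<in> Y" using assms by (auto simp: straddling_def)
  then have "{x, y} \<subseteq> T" "x \<noteq> y" using assms by auto
  then show "card T \<ge> 2" using card_mono[OF \<open>finite T\<close>, of "{x, y}"] by simp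
qed

text \<open>
  The single coordinate \<open>y\<close> belongs to every type and is placed last, so it contributes 1 to the
  exponent at every stage but the last one.  At the last stage exponent 1 leaves only the pairs
  \<open>{x, y}\<close>.  At the earlier stages exponent 1 forces \<open>T \<inter> X\<close> into two coordinates, which leaves three
  types; these are at most \<open>card X\<close> unless \<open>card X = 2\<close>, where only pairs are admitted.
\<close>

lemma total_error_bounded_singleton:
  assumes X: "finite X" "card X \<ge> 2" "y \<notin> X" and TT: "TT \<subseteq> straddling X {y}"
    and two: "card X = 2 \<Longrightarrow> \<forall>T\<in>TT. card T = 2"
  shows "total_error_bounded (insert y X) TT (card X)"
proof -
  obtain K where K: "K \<ge> 1" "\<And>n e. e \<ge> 5 / 4 \<Longrightarrow> (\<Sum>d\<in>{1..n}. real d powr - e) \<le> K"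
    using powr_sums_bounded by blast
  obtain xs where xs: "set xs = X" "distinct xs" using finite_distinct_list[OF \<open>finite X\<close>] by blast
  define s where "s = card X"
  define zs where "zs = y # xs"
  have len: "length xs = s" using xs distinct_card[of xs] by (simp add: s_def)
  have zs: "set zs = insert y X" "distinct zs" "length zs = Suc s"
    using xs X len by (auto simp: zs_def)
  have s: "s \<ge> 2" using X by (simp add: s_def)
  have cV: "card (insert y X) - 1 = s" using X by (simp add: s_def)
  have finTT: "finite TT" using TT X by (auto simp: straddling_def intro: finite_subset[of _ "Pow (insert y X)"])
  have T: "y \<in> T" "T \<inter> X \<noteq> {}" "T = insert y (X \<inter> T)" "finite T" "card T = Suc (card (X \<inter> T))" "card (X \<inter> T) \<ge> 1"
    if "T \<in> TT" for T
  proof -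
    show 1: "y \<in> T" "T \<inter> X \<noteq> {}" "T = insert y (X \<inter> T)" using that TT by (auto simp: straddling_def)
    show "finite T" using X by (subst 1(3)) auto
    show "card T = Suc (card (X \<inter> T))" using X by (subst 1(3)) auto
    show "card (X \<inter> T) \<ge> 1" using 1(2) X by (simp add: Suc_le_eq card_gt_0_iff Int_commute)
  qed
  have pairs: "card {T \<in> TT. card (X \<inter> T) = 1} \<le> s"
  proof -
    have "{T \<in> TT. card (X \<inter> T) = 1} \<subseteq> (\<lambda>x. {x, y}) ` X"
    proof
      fix T assume "T \<in> {T \<in> TT. card (X \<inter> T) = 1}"
      then have "T \<in> TT" "card (X \<inter> T) = 1" by auto
      then obtain x where "X \<inter> T = {x}" by (auto simp: card_1_singleton_iff)
      then show "T \<in> (\<lambda>x. {x, y}) ` X" using T(3)[OF \<open>T \<in> TT\<close>] by auto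
    qed
    then have "card {T \<in> TT. card (X \<inter> T) = 1} \<le> card ((\<lambda>x. {x, y}) ` X)"
      using X by (intro card_mono) auto
    also have "\<dots> \<le> s" unfolding s_def using X by (intro card_image_le)
    finally show ?thesis .
  qed
  have stage: "(\<forall>T\<in>TT. stage_exp zs j T \<ge> 1) \<and> card {T \<in> TT. stage_exp zs j T \<le> 1} \<le> s" if j: "j < s" for j
  proof (cases "s = 2")
    case True
    then have one: "card (X \<inter> T) = 1" if "T \<in> TT" for T
      using two T(5)[OF that] that by (fastforce simp: s_def)
    have "stage_exp zs j T \<ge> 1" if "T \<in> TT" for T
    proof (cases j)
      case 0
      then show ?thesis using one[OF that] by (simp add: stage_exp_def zs_def xs len True)
    next
      case (Suc i)
      have "set (take j zs) \<inter> T = insert y (set (take i xs) \<inter> T)"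
        using T(1)[OF that] by (simp add: zs_def Suc)
      then show ?thesis by (simp add: stage_exp_def card_gt_0_iff Suc_le_eq trans_less_add1)
    qed
    moreover have "card {T \<in> TT. stage_exp zs j T \<le> 1} \<le> s"
    proof -
      have "card {T \<in> TT. stage_exp zs j T \<le> 1} \<le> card {T \<in> TT. card (X \<inter> T) = 1}"
        using finTT one by (intro card_mono) auto
      then show ?thesis using pairs by simp
    qed
    ultimately show ?thesis by blast
  next
    case False
    then have s3: "s \<ge> 3" using s by simp
    show ?thesis
    proof (cases j)
      case 0
      have e: "stage_exp zs j T = min (card (X \<inter> T)) (s - 1)" for T
        by (simp add: stage_exp_def zs_def xs len 0)
      have "{T \<in> TT. stage_exp zs j T \<le> 1} \<subseteq> {T \<in> TT. card (X \<inter> T) = 1}"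
        using T(6) s3 by (force simp: e min_def split: if_splits)
      then have "card {T \<in> TT. stage_exp zs j T \<le> 1} \<le> card {T \<in> TT. card (X \<inter> T) = 1}"
        using finTT by (intro card_mono) auto
      with pairs have "card {T \<in> TT. stage_exp zs j T \<le> 1} \<le> s" by simp
      moreover have "stage_exp zs j T \<ge> 1" if "T \<in> TT" for T
        using T(6)[OF that] s3 by (simp add: e)
      ultimately show ?thesis by blast
    next
      case (Suc i)
      define a where "a = xs ! i"
      define b where "b = xs ! Suc i"
      have i: "Suc i < s" using j Suc by simp
      have e: "stage_exp zs j T = Suc (card (set (take i xs) \<inter> T))
          + min (card (set (drop (Suc i) xs) \<inter> T)) (s - i - 2)" if "T \<in> TT" for T
      proof -
        have "y \<notin> set (take i xs)" using X xs by (meson in_set_takeD)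
        then show ?thesis using T(1)[OF that] by (simp add: stage_exp_def zs_def Suc len)
      qed
      have "{T \<in> TT. stage_exp zs j T \<le> 1} \<subseteq> {{a, y}, {b, y}, {a, b, y}}"
      proof
        fix T assume "T \<in> {T \<in> TT. stage_exp zs j T \<le> 1}"
        then have TT: "T \<in> TT" and "stage_exp zs j T \<le> 1" by auto
        then have no: "set (take i xs) \<inter> T = {}" "s - i - 2 = 0 \<or> set (drop (Suc i) xs) \<inter> T = {}"
          using e[OF TT] by (auto simp: min_def split: if_splits)
        have "x \<in> {a, b}" if x: "x \<in> X \<inter> T" for x
        proof -
          obtain l where l: "l < s" "x = xs ! l" using x xs len by (auto simp: in_set_conv_nth)
          have "\<not> l < i"
          proof
            assume "l < i"
            then have "x \<in> set (take i xs)" using l len by (auto simp: in_set_conv_nth)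
            with no x show False by auto
          qed
          moreover have "l \<le> Suc i"
          proof (rule ccontr)
            assume "\<not> l \<le> Suc i"
            then have "x \<in> set (drop (Suc i) xs)" using l len
              by (auto simp: in_set_conv_nth intro!: exI[of _ "l - Suc i"])
            with no x \<open>\<not> l \<le> Suc i\<close> l show False by auto
          qed
          ultimately have "l = i \<or> l = Suc i" by auto
          then show ?thesis using l by (auto simp: a_def b_def)
        qed
        then have "X \<inter> T = {a} \<or> X \<inter> T = {b} \<or> X \<inter> T = {a, b}" using T(2)[OF TT] by blast
        then show "T \<in> {{a, y}, {b, y}, {a, b, y}}" using T(3)[OF TT] by auto
      qed
      then have "card {T \<in> TT. stage_exp zs j T \<le> 1} \<le> card {{a, y}, {b, y}, {a, b, y}}"
        by (intro card_mono) auto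
      also have "\<dots> \<le> 3" by (simp add: card_insert_if)
      also have "\<dots> \<le> s" by (rule s3)
      finally show ?thesis using e by auto
    qed
  qed
  define g where "g = (\<lambda>d. \<Sum>j<s. type_weight TT (\<lambda>T. real (stage_exp zs j T)) d)"
  have "(\<Sum>d\<in>TT \<rightarrow>\<^sub>E {1..n}. g d) \<le> real s * K ^ card TT * (1 + ln (real n)) ^ s" if "n > 0" for n
  proof -
    have "(\<Sum>d\<in>TT \<rightarrow>\<^sub>E {1..n}. g d)
        = (\<Sum>j<s. \<Sum>d\<in>TT \<rightarrow>\<^sub>E {1..n}. type_weight TT (\<lambda>T. real (stage_exp zs j T)) d)"
      unfolding g_def by (rule sum.swap)
    also have "\<dots> \<le> (\<Sum>j<s. K ^ card TT * (1 + ln (real n)) ^ s)"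
    proof (intro sum_mono sum_type_weight_le[OF finTT that K])
      fix j assume "j \<in> {..<s}"
      then have j: "\<forall>T\<in>TT. stage_exp zs j T \<ge> 1" "card {T \<in> TT. stage_exp zs j T \<le> 1} \<le> s"
        using stage[of j] by auto
      show "1 \<le> real (stage_exp zs j T)" if "T \<in> TT" for T using j that by force
      have "{T \<in> TT. real (stage_exp zs j T) < 5 / 4} = {T \<in> TT. stage_exp zs j T \<le> 1}" by auto
      with j show "card {T \<in> TT. real (stage_exp zs j T) < 5 / 4} \<le> s" by simp
    qed
    finally show ?thesis by (simp add: mult_ac)
  qed
  moreover have "\<forall>d. 0 \<le> g d" unfolding g_def by (intro allI sum_nonneg type_weight_nonneg)
  ultimately show ?thesis
    unfolding total_error_bounded_def s_def[symmetric] using zs cV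
    by (intro exI[of _ "real s * K ^ card TT"] exI[of _ g]) (auto simp: g_def)
qed

section \<open>Both groups have at least two coordinates\<close>

lemma card_straddling_pairs_le:
  assumes "finite X" "finite Y" "r \<in> X \<union> Y" "X \<inter> Y = {}"
  shows "card {T \<in> straddling X Y. r \<in> T \<and> card T = 2} \<le> max (card X) (card Y)"
proof -
  have *: "card {T \<in> straddling X Y. r \<in> T \<and> card T = 2} \<le> card Y"
    if "finite X" "finite Y" "r \<in> X" "X \<inter> Y = {}" for X Y :: "'a set"
  proof -
    have "{T \<in> straddling X Y. r \<in> T \<and> card T = 2} \<subseteq> (\<lambda>w. {r, w}) ` Y"
    proof
      fix T assume "T \<in> {T \<in> straddling X Y. r \<in> T \<and> card T = 2}"
      then have T: "T \<in> straddling X Y" "r \<in> T" "card T = 2" by auto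
      then obtain w where w: "w \<in> T" "w \<in> Y" by (auto simp: straddling_def)
      have "r \<noteq> w" using w that by auto
      then have "{r, w} = T"
        using T w that straddling_card_ge_2(1)[OF that(1,2,4) T(1)] by (intro card_subset_eq) auto
      with w show "T \<in> (\<lambda>w. {r, w}) ` Y" by auto
    qed
    then have "card {T \<in> straddling X Y. r \<in> T \<and> card T = 2} \<le> card ((\<lambda>w. {r, w}) ` Y)"
      using that by (intro card_mono) auto
    also have "\<dots> \<le> card Y" using that by (intro card_image_le)
    finally show ?thesis .
  qed
  show ?thesis
  proof (cases "r \<in> X")
    case True
    then show ?thesis using *[of X Y] assms by simp
  next
    case False
    then show ?thesis using *[of Y X] assms by (auto simp: straddling_commute[of X Y] Int_commute)
  qed
qed

text \<open>
  As soon as three coordinates have been placed, the condition lost with \<open>zs ! j\<close> is the only one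
  that matters: if a prime divides all coordinates placed before, their number minus one is still at
  least 2.
\<close>

lemma stage_exp_early:
  assumes "distinct zs" "T \<subseteq> set zs" "card T \<ge> 2" "j + 3 < length zs"
  shows "stage_exp zs j T \<ge> 1 \<and> (stage_exp zs j T \<le> 1 \<longrightarrow> zs ! j \<in> T \<and> card T = 2)"
proof -
  define A where "A = set (take j zs)"
  define W where "W = set (drop (Suc j) zs)"
  have zs: "zs = take j zs @ zs ! j # drop (Suc j) zs" using assms by (simp add: id_take_nth_drop)
  have d: "distinct (take j zs @ zs ! j # drop (Suc j) zs)" using assms(1) zs by simp
  have "T = (A \<inter> T) \<union> (({zs ! j} \<inter> T) \<union> (W \<inter> T))"
    using assms(2) unfolding A_def W_def by (subst (asm) zs) auto
  then have "card T = card ((A \<inter> T) \<union> (({zs ! j} \<inter> T) \<union> (W \<inter> T)))" by simp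
  also have "\<dots> = card (A \<inter> T) + (card ({zs ! j} \<inter> T) + card (W \<inter> T))"
    using d by (subst card_Un_disjoint; (subst card_Un_disjoint)?) (auto simp: A_def W_def)
  finally have c: "card T = card (A \<inter> T) + ((if zs ! j \<in> T then 1 else 0) + card (W \<inter> T))" by simp
  have "stage_exp zs j T = card (A \<inter> T) + min (card (W \<inter> T)) (length zs - j - 2)"
    by (simp add: stage_exp_def A_def W_def)
  with c assms(3,4) show ?thesis by (auto simp: min_def split: if_splits)
qed

text \<open>
  The two initial stages, where \<open>x\<close>, \<open>y\<close>, \<open>z\<close> is the order of placement.
\<close>

lemma stage_exp_last:
  assumes "distinct (R @ [z, y, x])" "T \<subseteq> set (R @ [z, y, x])"
  shows "stage_exp (R @ [z, y, x]) (length R) T = card (T - {x, y, z}) + min (card (T \<inter> {x, y})) 1"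
    and "stage_exp (R @ [z, y, x]) (Suc (length R)) T = card (T - {x, y})"
proof -
  have 1: "set R \<inter> T = T - {x, y, z}" using assms by auto
  have 2: "set (R @ [z]) \<inter> T = T - {x, y}" using assms by auto
  have 3: "{y, x} \<inter> T = T \<inter> {x, y}" by auto
  show "stage_exp (R @ [z, y, x]) (length R) T = card (T - {x, y, z}) + min (card (T \<inter> {x, y})) 1"
    by (simp add: stage_exp_def 1 3)
  show "stage_exp (R @ [z, y, x]) (Suc (length R)) T = card (T - {x, y})"
    using 2 by (simp add: stage_exp_def)
qed

lemma card_Diff_pair:
  assumes "finite T" "u \<noteq> v" "u \<notin> {p, q}" "v \<notin> {p, q}"
  shows "card (T - {p, q}) = of_bool (u \<in> T) + of_bool (v \<in> T) + card (T - {p, q, u, v})"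
proof -
  have "T - {p, q} = (T \<inter> {u, v}) \<union> (T - {p, q, u, v})" using assms by auto
  then have "card (T - {p, q}) = card ((T \<inter> {u, v}) \<union> (T - {p, q, u, v}))" by simp
  also have "\<dots> = card (T \<inter> {u, v}) + card (T - {p, q, u, v})"
    using assms by (intro card_Un_disjoint) auto
  also have "card (T \<inter> {u, v}) = of_bool (u \<in> T) + of_bool (v \<in> T)"
    using assms by (auto simp: Int_insert_right)
  finally show ?thesis .
qed

lemma card_Diff_triple:
  assumes "finite T" "v \<notin> {p, q, u}"
  shows "card (T - {p, q, u}) = of_bool (v \<in> T) + card (T - {p, q, u, v})"
proof -
  have "T - {p, q, u} = (T \<inter> {v}) \<union> (T - {p, q, u, v})" using assms by auto
  then have "card (T - {p, q, u}) = card ((T \<inter> {v}) \<union> (T - {p, q, u, v}))" by simp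
  also have "\<dots> = card (T \<inter> {v}) + card (T - {p, q, u, v})"
    using assms by (intro card_Un_disjoint) auto
  finally show ?thesis by (auto simp: Int_insert_right)
qed

text \<open>
  The first stage that starts with \<open>x\<close> and \<open>y\<close> has exponent \<open>card (T - {x, y})\<close>.  The four starts
  are averaged with weights 3/8 for those from \<open>{a, b}\<close> and \<open>{a, b'}\<close> and 1/8 for those from
  \<open>{a', b'}\<close> and \<open>{a', b}\<close>.  This gives exponent 3/4 at the two types of larger weight, 5/4 at
  the other two, and at least 5/4 at every other type.  The expression is a nested binary average,
  in the form in which it arises from repeated interpolation.
\<close>

definition pair_exp :: "'a \<Rightarrow> 'a \<Rightarrow> 'a \<Rightarrow> 'a \<Rightarrow> 'a set \<Rightarrow> real" where
  "pair_exp a a' b b' T =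
     1/2 * (3/4 * real (card (T - {a, b})) + (1 - 3/4) * real (card (T - {a', b'})))
   + (1 - 1/2) * (3/4 * real (card (T - {a, b'})) + (1 - 3/4) * real (card (T - {a', b})))"

lemma straddling_coordinates:
  fixes X Y :: "'a set"
  assumes XY: "finite X" "finite Y" "X \<inter> Y = {}"
    and ab: "a \<in> X" "a' \<in> X" "a \<noteq> a'" "b \<in> Y" "b' \<in> Y" "b \<noteq> b'"
    and T: "T \<in> straddling X Y"
  defines "w \<equiv> card (T - {a, a', b, b'})"
  shows "finite T"
    and "w = 0 \<Longrightarrow> (a \<in> T \<or> a' \<in> T) \<and> (b \<in> T \<or> b' \<in> T)"
    and "w \<ge> 2 \<or> w = 0 \<or> a \<in> T \<or> a' \<in> T \<or> b \<in> T \<or> b' \<in> T"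
    and "w = 0 \<Longrightarrow> T \<subseteq> {a, a', b, b'}"
proof -
  show fin: "finite T" using straddling_card_ge_2[OF XY T] by simp
  have sub: "T \<subseteq> {a, a', b, b'}" if "w = 0" using that fin by (auto simp: w_def)
  show "(a \<in> T \<or> a' \<in> T) \<and> (b \<in> T \<or> b' \<in> T)" if "w = 0"
  proof -
    obtain i j where "i \<in> T" "i \<in> X" "j \<in> T" "j \<in> Y" using T by (auto simp: straddling_def)
    with sub[OF that] ab XY show ?thesis by auto
  qed
  show "T \<subseteq> {a, a', b, b'}" if "w = 0" using sub[OF that] .
  show "w \<ge> 2 \<or> w = 0 \<or> a \<in> T \<or> a' \<in> T \<or> b \<in> T \<or> b' \<in> T"
  proof (rule ccontr)
    assume n: "\<not> ?thesis"
    then have "T - {a, a', b, b'} = T" by auto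
    with n straddling_card_ge_2(2)[OF XY T] show False by (simp add: w_def)
  qed
qed

lemma pair_exp_eq:
  assumes "finite T" "distinct [a, a', b, b']"
  shows "pair_exp a a' b b' T = 3/4 * of_bool (a' \<in> T) + 1/4 * of_bool (a \<in> T)
      + 1/2 * (of_bool (b \<in> T) + of_bool (b' \<in> T)) + real (card (T - {a, a', b, b'}))"
proof -
  have c: "T - {a, b, a', b'} = T - {a, a', b, b'}" "T - {a', b', a, b} = T - {a, a', b, b'}"
    "T - {a, b', a', b} = T - {a, a', b, b'}" "T - {a', b, a, b'} = T - {a, a', b, b'}" by auto
  have "card (T - {a, b}) = of_bool (a' \<in> T) + of_bool (b' \<in> T) + card (T - {a, a', b, b'})"
    "card (T - {a', b'}) = of_bool (a \<in> T) + of_bool (b \<in> T) + card (T - {a, a', b, b'})"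
    "card (T - {a, b'}) = of_bool (a' \<in> T) + of_bool (b \<in> T) + card (T - {a, a', b, b'})"
    "card (T - {a', b}) = of_bool (a \<in> T) + of_bool (b' \<in> T) + card (T - {a, a', b, b'})"
    using card_Diff_pair[OF assms(1), of a' b' a b] card_Diff_pair[OF assms(1), of a b a' b']
      card_Diff_pair[OF assms(1), of a' b a b'] card_Diff_pair[OF assms(1), of a b' a' b] assms(2)
    unfolding c by auto
  then show ?thesis by (simp add: pair_exp_def algebra_simps)
qed

lemma sum_ordered_pairs_straddling_le:
  fixes X Y :: "'a set"
  assumes XY: "finite X" "finite Y" "X \<inter> Y = {}" and n: "n > 0" "K \<ge> 1"
    and K: "\<And>n e. e \<ge> 5 / 4 \<Longrightarrow> (\<Sum>d\<in>{1..n}. real d powr - e) \<le> K"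
    and ab: "a \<in> X" "a' \<in> X" "a \<noteq> a'" "b \<in> Y" "b' \<in> Y" "b \<noteq> b'"
  defines "TT \<equiv> straddling X Y"
  shows "(\<Sum>d\<in>TT \<rightarrow>\<^sub>E {1..n}. if d {a, b} \<le> d {a', b'} \<and> d {a, b'} \<le> d {a', b}
            then type_weight TT (pair_exp a a' b b') d else 0)
           \<le> 16 * K ^ card TT * (1 + ln (real n)) ^ 2"
proof (rule sum_two_ordered_pairs_le[OF _ n K])
  have dist: "distinct [a, a', b, b']" using ab XY by auto
  show "finite TT" using XY by (auto simp: TT_def straddling_def intro: finite_subset[of _ "Pow (X \<union> Y)"])
  show "{a, b} \<in> TT" "{a', b'} \<in> TT" "{a, b'} \<in> TT" "{a', b} \<in> TT"
    using ab by (auto simp: TT_def straddling_def)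
  show "distinct [{a, b}, {a', b'}, {a, b'}, {a', b}]" using dist by (auto simp: doubleton_eq_iff)
  show "pair_exp a a' b b' {a, b} = 3 / 4" "pair_exp a a' b b' {a', b'} = 5 / 4"
    "pair_exp a a' b b' {a, b'} = 3 / 4" "pair_exp a a' b b' {a', b} = 5 / 4"
    using dist by (auto simp: pair_exp_eq[OF _ dist])
  show "pair_exp a a' b b' T \<ge> 5 / 4" if "T \<in> TT" "T \<notin> {{a, b}, {a, b'}}" for T
  proof -
    note c = straddling_coordinates[OF XY ab that(1)[unfolded TT_def]]
    define w where "w = card (T - {a, a', b, b'})"
    have eq: "pair_exp a a' b b' T = 3/4 * of_bool (a' \<in> T) + 1/4 * of_bool (a \<in> T)
      + 1/2 * (of_bool (b \<in> T) + of_bool (b' \<in> T)) + real w"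
      unfolding w_def by (rule pair_exp_eq[OF c(1) dist])
    show ?thesis
    proof (cases "w = 0")
      case True
      have "a' \<in> T \<or> (b \<in> T \<and> b' \<in> T)"
      proof (rule ccontr)
        assume "\<not> ?thesis"
        moreover have "T \<subseteq> {a, a', b, b'}" "a \<in> T \<or> a' \<in> T" "b \<in> T \<or> b' \<in> T"
          using c(2,4) True unfolding w_def by auto
        ultimately have "T = {a, b} \<or> T = {a, b'}" by blast
        with that show False by blast
      qed
      then show ?thesis using c(2) True unfolding eq w_def by auto
    next
      case False
      then have "w \<ge> 2 \<or> w = 1" by auto
      then show ?thesis
      proof
        assume "w \<ge> 2"
        then have "real w \<ge> 5 / 4" by simp
        moreover have "0 \<le> 3/4 * of_bool (a' \<in> T) + 1/4 * of_bool (a \<in> T)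
            + 1/2 * (of_bool (b \<in> T) + of_bool (b' \<in> T) :: real)" by simp
        ultimately show ?thesis unfolding eq by linarith
      next
        assume "w = 1"
        then have "a \<in> T \<or> a' \<in> T \<or> b \<in> T \<or> b' \<in> T" using c(3) unfolding w_def by auto
        then show ?thesis unfolding eq \<open>w = 1\<close> by auto
      qed
    qed
  qed
qed

text \<open>
  The average of the second stage exponents of the two orders that start with \<open>x\<close>, \<open>y\<close> and
  continue with \<open>x'\<close> or with \<open>y'\<close>.  Either order alone can have exponent 1 at too many types: with
  \<open>x'\<close> in third place these are \<open>{x, y}\<close>, \<open>{x, y, x'}\<close> and all pairs that contain \<open>x'\<close>.  In the average only
  \<open>{x, y}\<close> and \<open>{x', y'}\<close> keep exponent 1.
\<close>

definition second_exp :: "'a \<Rightarrow> 'a \<Rightarrow> 'a \<Rightarrow> 'a \<Rightarrow> 'a set \<Rightarrow> real" where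
  "second_exp x x' y y' T =
     1/2 * real (card (T - {x, y, x'}) + min (card (T \<inter> {x, y})) 1)
   + (1 - 1/2) * real (card (T - {x, y, y'}) + min (card (T \<inter> {x, y})) 1)"

lemma second_exp_ge:
  fixes X Y :: "'a set"
  assumes XY: "finite X" "finite Y" "X \<inter> Y = {}"
    and xy: "x \<in> X" "x' \<in> X" "x \<noteq> x'" "y \<in> Y" "y' \<in> Y" "y \<noteq> y'"
    and T: "T \<in> straddling X Y"
  shows "second_exp x x' y y' T \<ge> 1"
    and "second_exp x x' y y' T < 5 / 4 \<Longrightarrow> T \<in> {{x, y}, {x', y'}}"
proof -
  note c = straddling_coordinates[OF XY xy T]
  define w where "w = card (T - {x, x', y, y'})"
  have dist: "distinct [x, x', y, y']" using xy XY by auto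
  have s: "T - {x, y, x', y'} = T - {x, x', y, y'}" "T - {x, y, y', x'} = T - {x, x', y, y'}" by auto
  have "card (T - {x, y, x'}) = of_bool (y' \<in> T) + w" "card (T - {x, y, y'}) = of_bool (x' \<in> T) + w"
    using card_Diff_triple[OF c(1), of y' x y x'] card_Diff_triple[OF c(1), of x' x y y'] dist
    unfolding s w_def by auto
  moreover have "min (card (T \<inter> {x, y})) 1 = of_bool (x \<in> T \<or> y \<in> T)"
    using dist by (auto simp: Int_insert_right min_def)
  ultimately have eq: "second_exp x x' y y' T
      = 1/2 * (of_bool (y' \<in> T) + of_bool (x' \<in> T)) + real w + of_bool (x \<in> T \<or> y \<in> T)"
    by (simp add: second_exp_def algebra_simps)
  have "w = 0 \<or> w = 1 \<or> w \<ge> 2" by auto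
  then show "second_exp x x' y y' T \<ge> 1" using c(2,3) unfolding eq w_def[symmetric] by fastforce
  show "T \<in> {{x, y}, {x', y'}}" if small: "second_exp x x' y y' T < 5 / 4"
  proof -
    have "w = 0"
    proof (rule ccontr)
      assume "w \<noteq> 0"
      then have "w \<ge> 2 \<or> w = 1" by auto
      then show False
      proof
        assume "w \<ge> 2"
        then have "real w \<ge> 2" by simp
        moreover have "0 \<le> 1/2 * (of_bool (y' \<in> T) + of_bool (x' \<in> T)) + (of_bool (x \<in> T \<or> y \<in> T) :: real)" by simp
        ultimately show False using small unfolding eq by linarith
      next
        assume "w = 1"
        then have "x \<in> T \<or> x' \<in> T \<or> y \<in> T \<or> y' \<in> T" using c(3) unfolding w_def by auto
        then show False using small unfolding eq \<open>w = 1\<close>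
          by (cases "x \<in> T"; cases "x' \<in> T"; cases "y \<in> T"; cases "y' \<in> T"; simp)
      qed
    qed
    note c0 = c(2,4)[folded w_def, OF \<open>w = 0\<close>]
    show ?thesis
    proof (cases "x \<in> T \<or> y \<in> T")
      case True
      then have "x' \<notin> T \<and> y' \<notin> T" using small unfolding eq \<open>w = 0\<close>
        by (cases "x' \<in> T"; cases "y' \<in> T"; auto)
      then have "x' \<notin> T" "y' \<notin> T" by auto
      moreover from this have "x \<in> T" "y \<in> T" using c0(1) by auto
      ultimately have "T = {x, y}" using c0(2) by blast
      then show ?thesis by simp
    next
      case False
      then have "T = {x', y'}" using c0 by blast
      then show ?thesis by simp
    qed
  qed
qed

text \<open>
  Eight orders are used: start with one of the four pairs \<open>x\<close>, \<open>y\<close>, continue with the other chosen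
  coordinate of \<open>X\<close> or of \<open>Y\<close>, and place the remaining coordinates arbitrarily.  For a fixed start
  the two continuations share the first stage, so the better of the two second stages can be taken.
  What remains is below the first stage of every start; which of the four averages of these first
  stages is used depends on how \<open>d {x1, y1}\<close> compares with \<open>d {x2, y2}\<close>, and \<open>d {x1, y2}\<close> with
  \<open>d {x2, y1}\<close>.
\<close>

lemma total_error_bounded_straddling:
  fixes X Y :: "'a set"
  assumes XY: "finite X" "finite Y" "X \<inter> Y = {}" and cX: "card X \<ge> 2" and cY: "card Y \<ge> 2"
  shows "total_error_bounded (X \<union> Y) (straddling X Y) (max (card X) (card Y))"
proof -
  obtain K where K: "K \<ge> 1" "\<And>n e. e \<ge> 5 / 4 \<Longrightarrow> (\<Sum>d\<in>{1..n}. real d powr - e) \<le> K"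
    using powr_sums_bounded by blast
  define V where "V = X \<union> Y"
  define TT where "TT = straddling X Y"
  define M where "M = max (card X) (card Y)"
  define k where "k = card V"
  have finV: "finite V" using XY by (simp add: V_def)
  have finTT: "finite TT" using finV by (auto simp: TT_def straddling_def V_def intro: finite_subset[of _ "Pow (X \<union> Y)"])
  have k: "k \<ge> 4" using cX cY XY by (simp add: k_def V_def card_Un_disjoint)
  have M2: "M \<ge> 2" using cX by (simp add: M_def)
  have "\<exists>a\<in>A. \<exists>b\<in>A. a \<noteq> b" if "finite A" "card A \<ge> 2" for A :: "'a set"
  proof (rule ccontr)
    assume "\<not> ?thesis"
    then have "card A \<le> Suc 0" using card_le_Suc0_iff_eq[OF that(1)] by blast
    with that show False by simp
  qed
  then obtain x1 x2 y1 y2 where xy: "x1 \<in> X" "x2 \<in> X" "x1 \<noteq> x2" "y1 \<in> Y" "y2 \<in> Y" "y1 \<noteq> y2"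
    using XY cX cY by metis
  define other where "other = (\<lambda>z. if z = x1 then x2 else if z = x2 then x1 else if z = y1 then y2 else y1)"
  have dist: "distinct [x1, x2, y1, y2]" using xy XY by auto
  have other: "other x1 = x2" "other x2 = x1" "other y1 = y2" "other y2 = y1" using dist by (auto simp: other_def)

  define rest where "rest = (\<lambda>x y z. SOME xs. set xs = V - {x, y, z} \<and> distinct xs)"
  define ord where "ord = (\<lambda>x y z. rest x y z @ [z, y, x])"
  have rest: "set (rest x y z) = V - {x, y, z} \<and> distinct (rest x y z)" for x y z
    unfolding rest_def by (rule someI_ex) (use finV in \<open>simp add: finite_distinct_list\<close>)
  have ord: "set (ord x y z) = V" "distinct (ord x y z)" "length (ord x y z) = k" "length (rest x y z) = k - 3"
    if "x \<in> V" "y \<in> V" "z \<in> V" "distinct [x, y, z]" for x y z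
  proof -
    show 1: "set (ord x y z) = V" using that rest[of x y z] by (auto simp: ord_def)
    show 2: "distinct (ord x y z)" using that rest[of x y z] by (auto simp: ord_def)
    show 3: "length (ord x y z) = k" using distinct_card[OF 2] 1 by (simp add: k_def)
    then show "length (rest x y z) = k - 3" by (simp add: ord_def)
  qed
  define early where "early = (\<lambda>x y z d. \<Sum>j<k - 3. type_weight TT (\<lambda>T. real (stage_exp (ord x y z) j T)) d)"
  have early0: "early x y z d \<ge> 0" for x y z d
    unfolding early_def by (intro sum_nonneg type_weight_nonneg)
  define m1 where "m1 = (\<lambda>(x :: 'a) y T. real (card (T - {x, y})))"
  define m2 where "m2 = (\<lambda>(x :: 'a) y z T. real (card (T - {x, y, z}) + min (card (T \<inter> {x, y})) 1))"
  have stages: "(\<Sum>j<card V - 1. type_weight TT (\<lambda>T. real (stage_exp (ord x y z) j T)) d)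
      = early x y z d + type_weight TT (m2 x y z) d + type_weight TT (m1 x y) d"
    if "x \<in> V" "y \<in> V" "z \<in> V" "distinct [x, y, z]" for x y z d
  proof -
    note o = ord[OF that]
    have "k - 1 = Suc (Suc (k - 3))" using k by simp
    then have "(\<Sum>j<card V - 1. type_weight TT (\<lambda>T. real (stage_exp (ord x y z) j T)) d)
        = early x y z d + type_weight TT (\<lambda>T. real (stage_exp (ord x y z) (k - 3) T)) d
          + type_weight TT (\<lambda>T. real (stage_exp (ord x y z) (Suc (k - 3)) T)) d"
      by (simp add: early_def k_def)
    moreover have "type_weight TT (\<lambda>T. real (stage_exp (ord x y z) (k - 3) T)) d = type_weight TT (m2 x y z) d"
      "type_weight TT (\<lambda>T. real (stage_exp (ord x y z) (Suc (k - 3)) T)) d = type_weight TT (m1 x y) d"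
    proof -
      have "stage_exp (ord x y z) (k - 3) T = card (T - {x, y, z}) + min (card (T \<inter> {x, y})) 1"
        "stage_exp (ord x y z) (Suc (k - 3)) T = card (T - {x, y})" if "T \<in> TT" for T
      proof -
        have "T \<subseteq> set (ord x y z)" using that o by (simp add: TT_def straddling_def V_def)
        then show "stage_exp (ord x y z) (k - 3) T = card (T - {x, y, z}) + min (card (T \<inter> {x, y})) 1"
          "stage_exp (ord x y z) (Suc (k - 3)) T = card (T - {x, y})"
          using stage_exp_last[of "rest x y z" z y x T] o by (simp_all add: ord_def)
      qed
      then show "type_weight TT (\<lambda>T. real (stage_exp (ord x y z) (k - 3) T)) d = type_weight TT (m2 x y z) d"
        "type_weight TT (\<lambda>T. real (stage_exp (ord x y z) (Suc (k - 3)) T)) d = type_weight TT (m1 x y) d"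
        by (simp_all add: type_weight_def m1_def m2_def)
    qed
    ultimately show ?thesis by simp
  qed

  define G2 where "G2 = (\<lambda>x y d. type_weight TT (second_exp x (other x) y (other y)) d
      + early x y (other x) d + early x y (other y) d)"
  \<comment> \<open>The average is summable only where the parts of exponent 3/4 are the smaller ones.\<close>
  define H where "H = (\<lambda>a a' b b' d. if d {a, b} \<le> d {a', b'} \<and> d {a, b'} \<le> d {a', b}
      then type_weight TT (pair_exp a a' b b') d else 0)"
  define g where "g = (\<lambda>d. (H x1 x2 y1 y2 d + H x2 x1 y2 y1 d + H y1 y2 x1 x2 d + H y2 y1 x2 x1 d)
      + (G2 x1 y1 d + G2 x1 y2 d + G2 x2 y1 d + G2 x2 y2 d))"
  have G20: "G2 x y d \<ge> 0" for x y d by (simp add: G2_def type_weight_nonneg early0)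
  have H0: "H a a' b b' d \<ge> 0" for a a' b b' d by (simp add: H_def type_weight_nonneg)

  have "\<forall>d. 0 \<le> g d" by (simp add: g_def H0 G20)
  moreover have "r \<le> g d" if d: "\<forall>T\<in>TT. d T > 0"
    and r: "\<forall>zs. set zs = V \<longrightarrow> distinct zs \<longrightarrow>
             r \<le> (\<Sum>j<card V - 1. type_weight TT (\<lambda>T. real (stage_exp zs j T)) d)" for d r
  proof -
    have dpos: "\<And>T. T \<in> TT \<Longrightarrow> d T > 0" using d by blast
    have inner: "r \<le> type_weight TT (m1 x y) d + G2 x y d" if "x \<in> {x1, x2}" "y \<in> {y1, y2}" for x y
    proof -
      have v: "x \<in> V" "y \<in> V" "other x \<in> V" "other y \<in> V" "distinct [x, y, other x]" "distinct [x, y, other y]"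
        using that xy dist by (auto simp: other V_def)
      define q where "q = r - early x y (other x) d - early x y (other y) d - type_weight TT (m1 x y) d"
      have "r \<le> early x y (other x) d + type_weight TT (m2 x y (other x)) d + type_weight TT (m1 x y) d"
        using r ord(1,2)[OF v(1,2,3,5)] stages[OF v(1,2,3,5), of d] by metis
      then have q1: "q \<le> type_weight TT (m2 x y (other x)) d" using early0[of x y "other y" d] by (simp add: q_def)
      have "r \<le> early x y (other y) d + type_weight TT (m2 x y (other y)) d + type_weight TT (m1 x y) d"
        using r ord(1,2)[OF v(1,2,4,6)] stages[OF v(1,2,4,6), of d] by metis
      then have q2: "q \<le> type_weight TT (m2 x y (other y)) d" using early0[of x y "other x" d] by (simp add: q_def)
      have "q \<le> type_weight TT (\<lambda>T. 1/2 * m2 x y (other x) T + (1 - 1/2) * m2 x y (other y) T) d"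
        by (rule type_weight_interpolate[OF dpos finTT _ _ q1 q2]) auto
      also have "(\<lambda>T. 1/2 * m2 x y (other x) T + (1 - 1/2) * m2 x y (other y) T) = second_exp x (other x) y (other y)"
        by (simp add: fun_eq_iff second_exp_def m2_def)
      finally show ?thesis by (simp add: q_def G2_def)
    qed
    define D where "D = r - (G2 x1 y1 d + G2 x1 y2 d + G2 x2 y1 d + G2 x2 y2 d)"
    have D: "D \<le> type_weight TT (m1 x1 y1) d" "D \<le> type_weight TT (m1 x2 y2) d"
      "D \<le> type_weight TT (m1 x1 y2) d" "D \<le> type_weight TT (m1 x2 y1) d"
      using inner[of x1 y1] inner[of x1 y2] inner[of x2 y1] inner[of x2 y2]
        G20[of x1 y1 d] G20[of x1 y2 d] G20[of x2 y1 d] G20[of x2 y2 d]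
      by (auto simp: D_def)
    have m1c: "m1 x y = m1 y x" for x y by (simp add: m1_def insert_commute)
    have comb: "D \<le> type_weight TT (pair_exp a a' b b') d"
      if "D \<le> type_weight TT (m1 a b) d" "D \<le> type_weight TT (m1 a' b') d"
        "D \<le> type_weight TT (m1 a b') d" "D \<le> type_weight TT (m1 a' b) d" for a a' b b'
    proof -
      have "D \<le> type_weight TT (\<lambda>T. 1/2 * (3/4 * m1 a b T + (1 - 3/4) * m1 a' b' T)
          + (1 - 1/2) * (3/4 * m1 a b' T + (1 - 3/4) * m1 a' b T)) d"
        using that by (intro type_weight_interpolate dpos finTT) auto
      then show ?thesis by (simp add: pair_exp_def[abs_def] m1_def)
    qed
    have "D \<le> H x1 x2 y1 y2 d + H x2 x1 y2 y1 d + H y1 y2 x1 x2 d + H y2 y1 x2 x1 d"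
    proof -
      have ic: "{y, x} = {x, y}" for x y :: 'a by auto
      consider "d {x1, y1} \<le> d {x2, y2}" "d {x1, y2} \<le> d {x2, y1}"
        | "d {x2, y2} \<le> d {x1, y1}" "d {x2, y1} \<le> d {x1, y2}"
        | "d {x1, y1} \<le> d {x2, y2}" "d {x2, y1} \<le> d {x1, y2}"
        | "d {x2, y2} \<le> d {x1, y1}" "d {x1, y2} \<le> d {x2, y1}"
        by linarith
      then show ?thesis
      proof cases
        case 1
        then have "D \<le> H x1 x2 y1 y2 d" using comb[of x1 y1 x2 y2] D by (simp add: H_def)
        then show ?thesis using H0[of x2 x1 y2 y1 d] H0[of y1 y2 x1 x2 d] H0[of y2 y1 x2 x1 d] by linarith
      next
        case 2
        then have "D \<le> H x2 x1 y2 y1 d" using comb[of x2 y2 x1 y1] D by (simp add: H_def)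
        then show ?thesis using H0[of x1 x2 y1 y2 d] H0[of y1 y2 x1 x2 d] H0[of y2 y1 x2 x1 d] by linarith
      next
        case 3
        then have "D \<le> H y1 y2 x1 x2 d" using comb[of y1 x1 y2 x2] D
          by (simp add: H_def ic[of y1 x1] ic[of y2 x2] ic[of y1 x2] ic[of y2 x1] m1c[of y1 x1] m1c[of y2 x2] m1c[of y1 x2] m1c[of y2 x1])
        then show ?thesis using H0[of x1 x2 y1 y2 d] H0[of x2 x1 y2 y1 d] H0[of y2 y1 x2 x1 d] by linarith
      next
        case 4
        then have "D \<le> H y2 y1 x2 x1 d" using comb[of y2 x2 y1 x1] D
          by (simp add: H_def ic[of y1 x1] ic[of y2 x2] ic[of y1 x2] ic[of y2 x1] m1c[of y1 x1] m1c[of y2 x2] m1c[of y1 x2] m1c[of y2 x1])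
        then show ?thesis using H0[of x1 x2 y1 y2 d] H0[of x2 x1 y2 y1 d] H0[of y1 y2 x1 x2 d] by linarith
      qed
    qed
    then show ?thesis by (simp add: D_def g_def)
  qed
  moreover have "(\<Sum>d\<in>TT \<rightarrow>\<^sub>E {1..n}. g d) \<le> (4 * 16 + 4 * (1 + 2 * real k)) * K ^ card TT * (1 + ln (real n)) ^ M"
    if n: "n > 0" for n
  proof -
    define l where "l = 1 + ln (real n)"
    define C where "C = K ^ card TT * l ^ M"
    have l: "l \<ge> 1" using n by (simp add: l_def)
    have C0: "C \<ge> 0" unfolding C_def using l K(1) by (intro mult_nonneg_nonneg zero_le_power) auto
    have sumH: "(\<Sum>d\<in>TT \<rightarrow>\<^sub>E {1..n}. H a a' b b' d) \<le> 16 * C"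
      if "finite X'" "finite Y'" "X' \<inter> Y' = {}" "straddling X' Y' = TT"
        "a \<in> X'" "a' \<in> X'" "a \<noteq> a'" "b \<in> Y'" "b' \<in> Y'" "b \<noteq> b'" for a a' b b' X' Y'
    proof -
      have "(\<Sum>d\<in>TT \<rightarrow>\<^sub>E {1..n}. H a a' b b' d) \<le> 16 * K ^ card TT * l ^ 2"
        using sum_ordered_pairs_straddling_le[OF that(1-3) n K that(5-10)] unfolding that(4) H_def l_def .
      also have "\<dots> \<le> 16 * K ^ card TT * l ^ M"
        using M2 l K(1) by (intro mult_left_mono power_increasing) auto
      finally show ?thesis by (simp add: C_def)
    qed
    have sumE: "(\<Sum>d\<in>TT \<rightarrow>\<^sub>E {1..n}. early x y z d) \<le> real k * C"
      if v: "x \<in> V" "y \<in> V" "z \<in> V" "distinct [x, y, z]" for x y z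
    proof -
      note o = ord[OF v]
      have "(\<Sum>d\<in>TT \<rightarrow>\<^sub>E {1..n}. early x y z d)
          = (\<Sum>j<k - 3. \<Sum>d\<in>TT \<rightarrow>\<^sub>E {1..n}. type_weight TT (\<lambda>T. real (stage_exp (ord x y z) j T)) d)"
        unfolding early_def by (rule sum.swap)
      also have "\<dots> \<le> (\<Sum>j<k - 3. C)"
        unfolding C_def l_def
      proof (intro sum_mono sum_type_weight_le[OF finTT n K])
        fix j assume j: "j \<in> {..<k - 3}"
        have s: "stage_exp (ord x y z) j T \<ge> 1 \<and> (stage_exp (ord x y z) j T \<le> 1 \<longrightarrow> ord x y z ! j \<in> T \<and> card T = 2)"
          if "T \<in> TT" for T
          using that j o straddling_card_ge_2[OF XY that[unfolded TT_def]]
          by (intro stage_exp_early) (auto simp: TT_def straddling_def V_def)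
        show "1 \<le> real (stage_exp (ord x y z) j T)" if "T \<in> TT" for T using s[OF that] by simp
        have "ord x y z ! j \<in> set (ord x y z)" using j o(3) by (intro nth_mem) simp
        then have zin: "ord x y z ! j \<in> X \<union> Y" using o(1) by (simp add: V_def)
        have "{T \<in> TT. real (stage_exp (ord x y z) j T) < 5 / 4} \<subseteq> {T \<in> straddling X Y. ord x y z ! j \<in> T \<and> card T = 2}"
        proof
          fix T assume "T \<in> {T \<in> TT. real (stage_exp (ord x y z) j T) < 5 / 4}"
          then have "T \<in> TT" "stage_exp (ord x y z) j T \<le> 1" by auto
          then show "T \<in> {T \<in> straddling X Y. ord x y z ! j \<in> T \<and> card T = 2}" using s by (simp add: TT_def)
        qed
        then have "card {T \<in> TT. real (stage_exp (ord x y z) j T) < 5 / 4} \<le> card {T \<in> straddling X Y. ord x y z ! j \<in> T \<and> card T = 2}"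
          using finTT by (intro card_mono) (auto simp: TT_def)
        also have "\<dots> \<le> M" unfolding M_def by (rule card_straddling_pairs_le[OF XY(1,2) zin XY(3)])
        finally show "card {T \<in> TT. real (stage_exp (ord x y z) j T) < 5 / 4} \<le> M" .
      qed
      also have "\<dots> = real (k - 3) * C" by simp
      also have "\<dots> \<le> real k * C" using C0 by (intro mult_right_mono) auto
      finally show ?thesis .
    qed
    have sum2: "(\<Sum>d\<in>TT \<rightarrow>\<^sub>E {1..n}. type_weight TT (second_exp x x' y y') d) \<le> C"
      if "x \<in> X" "x' \<in> X" "x \<noteq> x'" "y \<in> Y" "y' \<in> Y" "y \<noteq> y'" for x x' y y'
      unfolding C_def l_def
    proof (rule sum_type_weight_le[OF finTT n K])
      note s = second_exp_ge[OF XY that]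
      show "1 \<le> second_exp x x' y y' T" if "T \<in> TT" for T using s(1) that by (simp add: TT_def)
      have "{T \<in> TT. second_exp x x' y y' T < 5 / 4} \<subseteq> {{x, y}, {x', y'}}" using s(2) by (auto simp: TT_def)
      then have "card {T \<in> TT. second_exp x x' y y' T < 5 / 4} \<le> card {{x, y}, {x', y'}}" by (intro card_mono) auto
      also have "\<dots> \<le> 2" by (simp add: card_insert_if)
      finally show "card {T \<in> TT. second_exp x x' y y' T < 5 / 4} \<le> M" using M2 by simp
    qed
    have sumG2: "(\<Sum>d\<in>TT \<rightarrow>\<^sub>E {1..n}. G2 x y d) \<le> (1 + 2 * real k) * C"
      if "x \<in> {x1, x2}" "y \<in> {y1, y2}" for x y
    proof -
      have v: "x \<in> V" "y \<in> V" "other x \<in> V" "other y \<in> V" "distinct [x, y, other x]" "distinct [x, y, other y]"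
        using that xy dist by (auto simp: other V_def)
      have "(\<Sum>d\<in>TT \<rightarrow>\<^sub>E {1..n}. type_weight TT (second_exp x (other x) y (other y)) d) \<le> C"
        using that xy by (intro sum2) (auto simp: other)
      then show ?thesis
        using sumE[OF v(1,2,3,5)] sumE[OF v(1,2,4,6)] by (simp add: G2_def sum.distrib algebra_simps)
    qed
    have "(\<Sum>d\<in>TT \<rightarrow>\<^sub>E {1..n}. g d) \<le> 4 * (16 * C) + 4 * ((1 + 2 * real k) * C)"
      using sumH[OF XY, of x1 x2 y1 y2] sumH[OF XY, of x2 x1 y2 y1]
        sumH[OF XY(2,1), of y1 y2 x1 x2] sumH[OF XY(2,1), of y2 y1 x2 x1]
        sumG2[of x1 y1] sumG2[of x1 y2] sumG2[of x2 y1] sumG2[of x2 y2] xy XY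
      by (simp add: g_def sum.distrib TT_def straddling_commute[of Y X] Int_commute)
    then show ?thesis by (simp add: C_def l_def algebra_simps)
  qed
  ultimately show ?thesis
    unfolding total_error_bounded_def V_def[symmetric] TT_def[symmetric] M_def[symmetric]
    by (intro exI[of _ "(4 * 16 + 4 * (1 + 2 * real k)) * K ^ card TT"] exI[of _ g] conjI allI impI) blast+
qed

section \<open>Local factors of the coprimality condition\<close>

text \<open>
  A type is a nonempty subset of \<open>X\<close> together with a nonempty subset of \<open>Y\<close>.  The identity serves
  twice: with \<open>a\<close> the indicator of divisibility by \<open>p\<close> it is inclusion-exclusion, and with
  \<open>a = 1 / p\<close> it evaluates the local density.
\<close>

lemma sum_over_straddling:
  fixes a :: "'a \<Rightarrow> real"
  assumes XY: "finite X" "finite Y" "X \<inter> Y = {}"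
  shows "(\<Sum>T\<in>straddling X Y. (-1) ^ card T * (\<Prod>i\<in>T. a i))
           = ((\<Prod>i\<in>X. 1 - a i) - 1) * ((\<Prod>i\<in>Y. 1 - a i) - 1)"
proof -
  define f where "f = (\<lambda>T. (-1) ^ card T * (\<Prod>i\<in>T. a i))"
  have nonempty: "(\<Sum>I\<in>Pow A - {{}}. f I) = (\<Prod>i\<in>A. 1 - a i) - 1" if "finite A" for A
  proof -
    have "(\<Prod>i\<in>A. 1 - a i) = (\<Sum>I\<in>Pow A. f I)"
      using prod_diff_conv_sum[OF that, of "\<lambda>_. 1" a] by (simp add: f_def)
    also have "\<dots> = f {} + (\<Sum>I\<in>Pow A - {{}}. f I)"
      using that by (subst sum.remove[of _ "{}"]) auto
    finally show ?thesis by (simp add: f_def)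
  qed
  have "(\<Sum>T\<in>straddling X Y. f T) = (\<Sum>(I, J)\<in>(Pow X - {{}}) \<times> (Pow Y - {{}}). f I * f J)"
  proof (rule sum.reindex_bij_witness[of _ "\<lambda>(I, J). I \<union> J" "\<lambda>T. (T \<inter> X, T \<inter> Y)"])
    fix T assume T: "T \<in> straddling X Y"
    then have "T = (T \<inter> X) \<union> (T \<inter> Y)" by (auto simp: straddling_def)
    moreover have "f ((T \<inter> X) \<union> (T \<inter> Y)) = f (T \<inter> X) * f (T \<inter> Y)"
      unfolding f_def using XY
      by (subst card_Un_disjoint; (subst prod.union_disjoint)?) (auto simp: power_add)
    ultimately show "(case (T \<inter> X, T \<inter> Y) of (I, J) \<Rightarrow> f I * f J) = f T" by simp
  qed (use XY in \<open>auto simp: straddling_def\<close>)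
  also have "\<dots> = (\<Sum>I\<in>Pow X - {{}}. f I) * (\<Sum>J\<in>Pow Y - {{}}. f J)"
    by (simp add: sum_product sum.cartesian_product)
  finally show ?thesis unfolding nonempty[OF XY(1)] nonempty[OF XY(2)] by (simp only: f_def)
qed

lemma coprime_products_iff:
  fixes x :: "'a \<Rightarrow> nat"
  assumes XY: "finite X" "finite Y" and x: "x \<in> lattice_points {} S0 (X \<union> Y) n"
  shows "coprime (\<Prod>i\<in>X. x i) (\<Prod>i\<in>Y. x i)
     \<longleftrightarrow> (\<forall>p\<in>{p. prime p \<and> p \<le> n}. \<not> ((\<exists>i\<in>X. p dvd x i) \<and> (\<exists>i\<in>Y. p dvd x i)))"
proof -
  have dv: "p dvd (\<Prod>i\<in>A. x i) \<longleftrightarrow> (\<exists>i\<in>A. p dvd x i)" if "prime p" "finite A" for p A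
    using that prime_dvd_prod_iff[of A p x] by auto
  have le: "p \<le> n" if "i \<in> X" "p dvd x i" for p i
  proof -
    have "x i > 0" using x that by (auto simp: lattice_points_def PiE_iff Suc_le_eq)
    moreover have "x i \<le> n"
      using x that XY member_le_sum[of i "X \<union> Y" x] by (auto simp: lattice_points_def)
    ultimately show ?thesis using dvd_imp_le[OF that(2)] by simp
  qed
  have "coprime (\<Prod>i\<in>X. x i) (\<Prod>i\<in>Y. x i)
      \<longleftrightarrow> (\<forall>p. prime p \<longrightarrow> \<not> (p dvd (\<Prod>i\<in>X. x i) \<and> p dvd (\<Prod>i\<in>Y. x i)))"
  proof
    assume "coprime (\<Prod>i\<in>X. x i) (\<Prod>i\<in>Y. x i)"
    then show "\<forall>p. prime p \<longrightarrow> \<not> (p dvd (\<Prod>i\<in>X. x i) \<and> p dvd (\<Prod>i\<in>Y. x i))"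
      by (meson coprime_common_divisor not_prime_unit)
  next
    assume np: "\<forall>p. prime p \<longrightarrow> \<not> (p dvd (\<Prod>i\<in>X. x i) \<and> p dvd (\<Prod>i\<in>Y. x i))"
    show "coprime (\<Prod>i\<in>X. x i) (\<Prod>i\<in>Y. x i)"
    proof (rule ccontr)
      assume "\<not> ?thesis"
      then have "gcd (\<Prod>i\<in>X. x i) (\<Prod>i\<in>Y. x i) \<noteq> 1" by (simp add: coprime_iff_gcd_eq_1)
      then obtain p where "prime p" "p dvd gcd (\<Prod>i\<in>X. x i) (\<Prod>i\<in>Y. x i)"
        using prime_factor_nat by blast
      with np show False by auto
    qed
  qed
  also have "\<dots> \<longleftrightarrow> (\<forall>p\<in>{p. prime p \<and> p \<le> n}. \<not> ((\<exists>i\<in>X. p dvd x i) \<and> (\<exists>i\<in>Y. p dvd x i)))"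
    using dv XY le by auto
  finally show ?thesis .
qed

lemma prod_of_bool:
  assumes "finite A"
  shows "(\<Prod>p\<in>A. of_bool (P p)) = (of_bool (\<forall>p\<in>A. P p) :: real)"
  using assms by (induction A rule: finite_induct) auto

definition coprime_count :: "'a set \<Rightarrow> 'a set \<Rightarrow> nat \<Rightarrow> nat" where
  "coprime_count X Y n = card {x \<in> X \<union> Y \<rightarrow>\<^sub>E {1..}. sum x (X \<union> Y) = n \<and>
      coprime (\<Prod>i\<in>X. x i) (\<Prod>i\<in>Y. x i)}"

text \<open>
  The probability that a random residue vector modulo \<open>p\<close> with coordinate sum \<open>n\<close> satisfies the
  coprimality condition at \<open>p\<close>.  Without the constraint on the sum it is the first line; the second
  line corrects the type that consists of all coordinates.
\<close>

definition local_factor :: "nat \<Rightarrow> nat \<Rightarrow> nat \<Rightarrow> nat \<Rightarrow> real" where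
  "local_factor s t n p = 1 - (1 - (1 - 1 / real p) ^ s) * (1 - (1 - 1 / real p) ^ t)
     + (-1) ^ (s + t - 1) * (of_bool (p dvd n) / real p ^ (s + t - 1) - 1 / real p ^ (s + t))"

lemma weighted_count_estimate:
  fixes V :: "'a set" and kappa :: "nat \<Rightarrow> nat \<Rightarrow> 'a set \<Rightarrow> real"
  assumes V: "finite V" "card V \<ge> 3" and TT: "TT \<subseteq> Pow V" "\<And>T. T \<in> TT \<Longrightarrow> card T \<ge> 2"
    and err: "total_error_bounded V TT M"
    and kappa: "\<And>n p T. T \<in> insert {} TT \<Longrightarrow> \<bar>kappa n p T\<bar> \<le> 1"
    and w: "\<And>n x. n > 0 \<Longrightarrow> x \<in> lattice_points {} (\<lambda>_. {}) V n \<Longrightarrow>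
       w n x = (\<Prod>p | prime p \<and> p \<le> n. \<Sum>T\<in>insert {} TT. kappa n p T * (if \<forall>i\<in>T. p dvd x i then 1 else 0))"
  shows "\<exists>C. \<forall>n>0. \<bar>(\<Sum>x\<in>lattice_points {} (\<lambda>_. {}) V n. w n x) - real n ^ (card V - 1) / fact (card V - 1)
        * (\<Prod>p | prime p \<and> p \<le> n. \<Sum>T\<in>insert {} TT. kappa n p T * local_density V n p T)\<bar>
      \<le> C * (real n ^ (card V - 2) * (1 + ln (real n)) ^ M)"
proof -
  obtain C g where g0: "\<forall>d. 0 \<le> g d"
    and g: "\<forall>d r. (\<forall>T\<in>TT. d T > 0) \<longrightarrow> (\<forall>zs. set zs = V \<longrightarrow> distinct zs \<longrightarrow>
           r \<le> (\<Sum>j<card V - 1. type_weight TT (\<lambda>T. real (stage_exp zs j T)) d)) \<longrightarrow> r \<le> g d"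
    and C: "\<forall>n>0. (\<Sum>d\<in>TT \<rightarrow>\<^sub>E {1..n}. g d) \<le> C * (1 + ln (real n)) ^ M"
    using err unfolding total_error_bounded_def by blast
  define B where "B = real (card TT) * 2 ^ card TT"
  show ?thesis
  proof (intro exI[of _ "C + B"] allI impI)
    fix n :: nat assume n: "n > 0"
    have l: "(1 + ln (real n)) ^ M \<ge> 1" using n by (intro one_le_power) simp
    have "\<bar>(\<Sum>x\<in>lattice_points {} (\<lambda>_. {}) V n. w n x) - real n ^ (card V - 1) / fact (card V - 1)
        * (\<Prod>p | prime p \<and> p \<le> n. \<Sum>T\<in>insert {} TT. kappa n p T * local_density V n p T)\<bar>
      \<le> real n ^ (card V - 2) * ((\<Sum>d\<in>TT \<rightarrow>\<^sub>E {1..n}. g d) + real (card TT) * 2 ^ card TT)"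
    proof (rule weighted_count_asymptotic[OF V n TT kappa w[OF n] _ spec[OF g0]])
      fix d :: "'a set \<Rightarrow> nat" and r
      assume d: "d \<in> TT \<rightarrow>\<^sub>E {1..n}"
        and r: "\<And>zs. set zs = V \<Longrightarrow> distinct zs \<Longrightarrow>
            r \<le> (\<Sum>j<card V - 1. type_weight TT (\<lambda>T. real (stage_exp zs j T)) d)"
      have "\<forall>T\<in>TT. d T > 0" using d by (auto simp: PiE_iff Suc_le_eq)
      then show "r \<le> g d" using g r by blast
    qed
    also have "\<dots> \<le> real n ^ (card V - 2) * (C * (1 + ln (real n)) ^ M + B * (1 + ln (real n)) ^ M)"
    proof (intro mult_left_mono add_mono)
      show "(\<Sum>d\<in>TT \<rightarrow>\<^sub>E {1..n}. g d) \<le> C * (1 + ln (real n)) ^ M" using C n by blast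
      show "real (card TT) * 2 ^ card TT \<le> B * (1 + ln (real n)) ^ M"
        using mult_left_mono[OF l, of B] by (simp add: B_def)
    qed auto
    finally show "\<bar>(\<Sum>x\<in>lattice_points {} (\<lambda>_. {}) V n. w n x) - real n ^ (card V - 1) / fact (card V - 1)
        * (\<Prod>p | prime p \<and> p \<le> n. \<Sum>T\<in>insert {} TT. kappa n p T * local_density V n p T)\<bar>
      \<le> (C + B) * (real n ^ (card V - 2) * (1 + ln (real n)) ^ M)"
      by (simp add: algebra_simps)
  qed
qed

definition count_estimate :: "'a set \<Rightarrow> 'a set \<Rightarrow> bool" where
  "count_estimate X Y \<longleftrightarrow> (\<exists>C. \<forall>n>0.
     \<bar>real (coprime_count X Y n) - real n ^ (card X + card Y - 1) / fact (card X + card Y - 1)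
        * (\<Prod>p | prime p \<and> p \<le> n. local_factor (card X) (card Y) n p)\<bar>
      \<le> C * (real n ^ (card X + card Y - 2) * (1 + ln (real n)) ^ max (card X) (card Y)))"

lemma count_estimate_commute: "count_estimate X Y = count_estimate Y X"
  unfolding count_estimate_def coprime_count_def local_factor_def
  by (simp add: Un_commute[of X Y] add.commute[of "card X"] max.commute[of "card X"] coprime_commute
      mult.commute[of "1 - (1 - 1 / real _) ^ card X"])

lemma count_estimate_general:
  fixes X Y :: "'a set" and kappa :: "nat \<Rightarrow> nat \<Rightarrow> 'a set \<Rightarrow> real"
  assumes XY: "finite X" "finite Y" "X \<inter> Y = {}" "card X + card Y \<ge> 3"
    and TT: "TT \<subseteq> straddling X Y" and err: "total_error_bounded (X \<union> Y) TT (max (card X) (card Y))"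
    and kappa: "\<And>n p T. T \<in> insert {} TT \<Longrightarrow> \<bar>kappa n p T\<bar> \<le> 1"
    and ind: "\<And>n p x. \<lbrakk>prime p; x \<in> lattice_points {} (\<lambda>_. {}) (X \<union> Y) n\<rbrakk> \<Longrightarrow>
        (\<Sum>T\<in>insert {} TT. kappa n p T * (if \<forall>i\<in>T. p dvd x i then 1 else 0))
        = of_bool (\<not> ((\<exists>i\<in>X. p dvd x i) \<and> (\<exists>i\<in>Y. p dvd x i)))"
    and loc: "\<And>n p. prime p \<Longrightarrow> (\<Sum>T\<in>insert {} TT. kappa n p T * local_density (X \<union> Y) n p T)
        = local_factor (card X) (card Y) n p"
  shows "count_estimate X Y"
proof -
  define V where "V = X \<union> Y"
  have V: "finite V" "card V = card X + card Y" using XY by (auto simp: V_def card_Un_disjoint)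
  have "\<exists>C. \<forall>n>0. \<bar>(\<Sum>x\<in>lattice_points {} (\<lambda>_. {}) V n. of_bool (coprime (\<Prod>i\<in>X. x i) (\<Prod>i\<in>Y. x i)))
        - real n ^ (card V - 1) / fact (card V - 1)
        * (\<Prod>p | prime p \<and> p \<le> n. \<Sum>T\<in>insert {} TT. kappa n p T * local_density V n p T)\<bar>
      \<le> C * (real n ^ (card V - 2) * (1 + ln (real n)) ^ max (card X) (card Y))"
  proof (rule weighted_count_estimate[OF V(1) _ _ _ err[folded V_def] kappa])
    show "card V \<ge> 3" using V XY by simp
    show "TT \<subseteq> Pow V" using TT by (auto simp: straddling_def V_def)
    show "card T \<ge> 2" if "T \<in> TT" for T
      using straddling_card_ge_2(2)[OF XY(1-3)] that TT by auto
    fix n x assume x: "x \<in> lattice_points {} (\<lambda>_. {}) V n"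
    have fin: "finite {p. prime p \<and> p \<le> n}" by (rule finite_subset[of _ "{..n}"]) auto
    have "(of_bool (coprime (\<Prod>i\<in>X. x i) (\<Prod>i\<in>Y. x i)) :: real)
        = (\<Prod>p | prime p \<and> p \<le> n. of_bool (\<not> ((\<exists>i\<in>X. p dvd x i) \<and> (\<exists>i\<in>Y. p dvd x i))))"
      unfolding coprime_products_iff[OF XY(1,2) x[unfolded V_def]]
      by (rule prod_of_bool[OF fin, symmetric])
    also have "\<dots> = (\<Prod>p | prime p \<and> p \<le> n. \<Sum>T\<in>insert {} TT. kappa n p T * (if \<forall>i\<in>T. p dvd x i then 1 else 0))"
      using ind x by (intro prod.cong) (auto simp: V_def)
    finally show "(of_bool (coprime (\<Prod>i\<in>X. x i) (\<Prod>i\<in>Y. x i)) :: real) = \<dots>" .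
  qed auto
  moreover have "(\<Sum>x\<in>lattice_points {} (\<lambda>_. {}) V n. of_bool (coprime (\<Prod>i\<in>X. x i) (\<Prod>i\<in>Y. x i)))
      = real (coprime_count X Y n)" for n
  proof -
    have "{x \<in> V \<rightarrow>\<^sub>E {1..}. sum x V = n \<and> coprime (\<Prod>i\<in>X. x i) (\<Prod>i\<in>Y. x i)}
        = {x \<in> lattice_points {} (\<lambda>_. {}) V n. coprime (\<Prod>i\<in>X. x i) (\<Prod>i\<in>Y. x i)}"
      by (auto simp: lattice_points_def)
    then show ?thesis
      unfolding coprime_count_def V_def[symmetric] using finite_lattice_points[OF V(1), of "{}" "\<lambda>_. {}" n]
      by (simp add: of_bool_def sum.inter_filter[symmetric])
  qed
  moreover have "(\<Prod>p | prime p \<and> p \<le> n. \<Sum>T\<in>insert {} TT. kappa n p T * local_density V n p T)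
      = (\<Prod>p | prime p \<and> p \<le> n. local_factor (card X) (card Y) n p)" for n
    using loc by (intro prod.cong) (auto simp: V_def)
  ultimately show ?thesis unfolding count_estimate_def V(2) by simp
qed

lemma count_estimate_straddling:
  fixes X Y :: "'a set"
  assumes XY: "finite X" "finite Y" "X \<inter> Y = {}" "card X + card Y \<ge> 3"
    and ne: "X \<noteq> {}" "Y \<noteq> {}"
    and err: "total_error_bounded (X \<union> Y) (straddling X Y) (max (card X) (card Y))"
  shows "count_estimate X Y"
proof (rule count_estimate_general[OF XY subset_refl err, of "\<lambda>n p T. if T = {} then 1 else - ((-1) ^ card T)"])
  define V where "V = X \<union> Y"
  define TT where "TT = straddling X Y"
  define k where "k = card X + card Y"
  have V: "finite V" "card V = k" using XY by (auto simp: V_def k_def card_Un_disjoint)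
  have finTT: "finite TT" using XY by (auto simp: TT_def straddling_def intro: finite_subset[of _ "Pow (X \<union> Y)"])
  have neTT: "{} \<notin> TT" by (auto simp: TT_def straddling_def)
  have split: "(\<Sum>T\<in>insert {} TT. (if T = {} then 1 else - ((-1) ^ card T)) * f T)
      = f {} - (\<Sum>T\<in>TT. (-1) ^ card T * f T)" for f :: "'a set \<Rightarrow> real"
  proof -
    have "(\<Sum>T\<in>TT. (if T = {} then 1 else - ((-1) ^ card T)) * f T) = (\<Sum>T\<in>TT. - ((-1) ^ card T * f T))"
      using neTT by (intro sum.cong) auto
    then show ?thesis using finTT neTT by (simp add: sum_negf)
  qed
  show "\<bar>if T = {} then 1 else - ((-1) ^ card T) :: real\<bar> \<le> 1" for T :: "'a set" by (simp add: power_abs)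
  show "(\<Sum>T\<in>insert {} (straddling X Y). (if T = {} then 1 else - ((-1) ^ card T)) * (if \<forall>i\<in>T. p dvd x i then 1 else 0))
      = (of_bool (\<not> ((\<exists>i\<in>X. p dvd x i) \<and> (\<exists>i\<in>Y. p dvd x i))) :: real)" for p n and x :: "'a \<Rightarrow> nat"
  proof -
    have "(if \<forall>i\<in>T. p dvd x i then 1 else 0) = (\<Prod>i\<in>T. of_bool (p dvd x i) :: real)" if "T \<in> TT" for T
    proof -
      have "finite T" using that XY by (auto simp: TT_def straddling_def intro: finite_subset)
      then show ?thesis by (auto simp: prod_zero_iff)
    qed
    then have "(\<Sum>T\<in>TT. (-1) ^ card T * (if \<forall>i\<in>T. p dvd x i then 1 else 0))
        = (\<Sum>T\<in>TT. (-1) ^ card T * (\<Prod>i\<in>T. of_bool (p dvd x i) :: real))" by simp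
    also have "\<dots> = ((\<Prod>i\<in>X. 1 - of_bool (p dvd x i)) - 1) * ((\<Prod>i\<in>Y. 1 - of_bool (p dvd x i)) - 1)"
      unfolding TT_def by (rule sum_over_straddling[OF XY(1-3)])
    also have "(\<Prod>i\<in>A. 1 - of_bool (p dvd x i) :: real) = of_bool (\<not> (\<exists>i\<in>A. p dvd x i))" if "finite A" for A
      using that by (auto simp: prod_zero_iff intro!: prod.neutral)
    finally show ?thesis unfolding TT_def[symmetric] split using XY by auto
  qed
  show "(\<Sum>T\<in>insert {} (straddling X Y). (if T = {} then 1 else - ((-1) ^ card T)) * local_density (X \<union> Y) n p T)
      = local_factor (card X) (card Y) n p" if p: "prime p" for n p
  proof -
    define u where "u = 1 / real p"
    have "V \<noteq> {}" using V XY by (auto simp: k_def)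
    then have ld0: "local_density V n p {} = 1" by (auto simp: local_density_def)
    define c where "c = of_bool (p dvd n) / real p ^ (k - 1) - 1 / real p ^ k"
    have ld: "local_density V n p T = (\<Prod>i\<in>T. u) + (if T = V then c else 0)" if "T \<in> TT" for T
    proof -
      have "T \<subseteq> V" using that by (auto simp: TT_def straddling_def V_def)
      then show ?thesis
        by (cases "T = V") (auto simp: local_density_def V c_def u_def power_one_over Int_absorb1)
    qed
    have "(\<Sum>T\<in>TT. (-1) ^ card T * local_density V n p T)
        = (\<Sum>T\<in>TT. (-1) ^ card T * (\<Prod>i\<in>T. u)) + (\<Sum>T\<in>TT. if T = V then (-1) ^ card T * c else 0)"
      unfolding sum.distrib[symmetric] using ld by (intro sum.cong) (auto simp: algebra_simps)
    also have "(\<Sum>T\<in>TT. (-1) ^ card T * (\<Prod>i\<in>T. u)) = ((1 - u) ^ card X - 1) * ((1 - u) ^ card Y - 1)"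
      unfolding TT_def using sum_over_straddling[OF XY(1-3), of "\<lambda>_. u"] by simp
    also have "(\<Sum>T\<in>TT. if T = V then (-1) ^ card T * c else 0) = (-1) ^ k * c"
      using finTT V ne by (simp add: sum.delta TT_def straddling_def V_def Int_Un_distrib2 Un_Int_eq)
    finally have "(\<Sum>T\<in>TT. (-1) ^ card T * local_density V n p T)
        = ((1 - u) ^ card X - 1) * ((1 - u) ^ card Y - 1) + (-1) ^ k * c" .
    moreover have "(-1 :: real) ^ k = - ((-1) ^ (k - 1))" using XY(4) by (cases k) (auto simp: k_def)
    ultimately show ?thesis
      unfolding TT_def[symmetric] V_def[symmetric] split ld0 local_factor_def k_def[symmetric] c_def u_def
      by (simp add: algebra_simps)
  qed
qed

text \<open>
  For \<open>p dvd n\<close> a prime that divides \<open>x y\<close> and one of \<open>x a\<close>, \<open>x b\<close> divides both, so the single type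
  \<open>{a, y}\<close> describes the failure of coprimality.  For other primes \<open>p\<close> the types \<open>{a, y}\<close> and
  \<open>{b, y}\<close> exclude each other.  In this way only two types occur, and the type \<open>{a, b, y}\<close>, whose
  exponent would be 1 at the first stage, is avoided.
\<close>

lemma count_estimate_triple:
  fixes a b y :: 'a
  assumes dist: "distinct [a, b, y]"
  shows "count_estimate {a, b} {y}"
proof -
  define TT where "TT = {{a, y}, {b, y}}"
  define kappa where "kappa = (\<lambda>n p :: nat. \<lambda>T. if T = {} then 1
     else if T = {a, y} then - 1 else if p dvd n then 0 else - 1 :: real)"
  have sets: "{a, y} \<noteq> {b, y}" "{a, y} \<noteq> {}" "{b, y} \<noteq> {}" using dist by (auto simp: doubleton_eq_iff)
  have sum3: "(\<Sum>T\<in>insert {} TT. f T) = f {} + (f {a, y} + f {b, y})" for f :: "'a set \<Rightarrow> real"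
    using sets by (simp add: TT_def)
  show ?thesis
  proof (rule count_estimate_general[of "{a, b}" "{y}" TT kappa])
    show "finite {a, b}" "finite {y}" "{a, b} \<inter> {y} = {}" "card {a, b} + card {y} \<ge> 3"
      using dist by auto
    show TT: "TT \<subseteq> straddling {a, b} {y}" by (auto simp: TT_def straddling_def)
    have "total_error_bounded (insert y {a, b}) TT (card {a, b})"
    proof (rule total_error_bounded_singleton[OF _ _ _ TT])
      show "\<forall>T\<in>TT. card T = 2" using dist by (simp add: TT_def)
    qed (use dist in auto)
    moreover have "{a, b} \<union> {y} = insert y {a, b}" "max (card {a, b}) (card {y}) = card {a, b}"
      using dist by auto
    ultimately show "total_error_bounded ({a, b} \<union> {y}) TT (max (card {a, b}) (card {y}))"
      by (simp only:)
    show "\<bar>kappa n p T\<bar> \<le> 1" for n p T by (simp add: kappa_def)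
    show "(\<Sum>T\<in>insert {} TT. kappa n p T * (if \<forall>i\<in>T. p dvd x i then 1 else 0))
        = of_bool (\<not> ((\<exists>i\<in>{a, b}. p dvd x i) \<and> (\<exists>i\<in>{y}. p dvd x i)))"
      if x: "x \<in> lattice_points {} (\<lambda>_. {}) ({a, b} \<union> {y}) n" for n p x
    proof -
      have n: "n = x a + x b + x y" using x dist by (auto simp: lattice_points_def)
      have "p dvd n \<longleftrightarrow> (p dvd x a \<longleftrightarrow> p dvd x b)" if "p dvd x y" "p dvd x a \<or> p dvd x b"
        using that unfolding n by (auto simp: dvd_add_left_iff dvd_add_right_iff)
      then show ?thesis unfolding sum3 using sets by (auto simp: kappa_def)
    qed
    show "(\<Sum>T\<in>insert {} TT. kappa n p T * local_density ({a, b} \<union> {y}) n p T)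
        = local_factor (card {a, b}) (card {y}) n p" if "prime p" for n p
    proof -
      define u where "u = 1 / real p"
      have "({a, b} \<union> {y}) \<inter> {a, y} = {a, y}" "({a, b} \<union> {y}) \<inter> {b, y} = {b, y}" by auto
      then have "local_density ({a, b} \<union> {y}) n p {} = 1"
        "local_density ({a, b} \<union> {y}) n p {a, y} = u ^ 2"
        "local_density ({a, b} \<union> {y}) n p {b, y} = u ^ 2"
        using dist by (auto simp: local_density_def u_def power_one_over power2_eq_square)
      then have "(\<Sum>T\<in>insert {} TT. kappa n p T * local_density ({a, b} \<union> {y}) n p T)
          = 1 - 2 * u ^ 2 + of_bool (p dvd n) * u ^ 2"
        unfolding sum3 using sets by (simp add: kappa_def)
      also have "\<dots> = 1 - (1 - (1 - u) ^ 2) * (1 - (1 - u) ^ 1) + (of_bool (p dvd n) * u ^ 2 - u ^ 3)"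
        by (simp add: power2_eq_square power3_eq_cube algebra_simps)
      also have "\<dots> = local_factor 2 1 n p"
        by (simp add: local_factor_def u_def power_one_over)
      finally show ?thesis using dist by (simp add: numeral_2_eq_2)
    qed
  qed
qed

theorem count_estimate:
  fixes X Y :: "'a set"
  assumes XY: "finite X" "finite Y" "X \<inter> Y = {}" "X \<noteq> {}" "Y \<noteq> {}" and k: "card X + card Y \<ge> 3"
  shows "count_estimate X Y"
proof -
  have single: "count_estimate X {y}" if "finite X" "y \<notin> X" "card X \<ge> 2" for X :: "'a set" and y
  proof (cases "card X = 2")
    case True
    then obtain a b where "X = {a, b}" "a \<noteq> b" by (auto simp: card_2_iff)
    then show ?thesis using that by (auto intro!: count_estimate_triple)
  next
    case False
    have "total_error_bounded (insert y X) (straddling X {y}) (card X)"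
      using that False by (intro total_error_bounded_singleton) auto
    moreover have "X \<union> {y} = insert y X" "max (card X) (card {y}) = card X" using that by auto
    ultimately have "total_error_bounded (X \<union> {y}) (straddling X {y}) (max (card X) (card {y}))"
      by (simp only:)
    then show ?thesis using that by (intro count_estimate_straddling) auto
  qed
  have pos: "card X \<ge> 1" "card Y \<ge> 1" using XY by (auto simp: Suc_le_eq card_gt_0_iff)
  consider "card Y = 1" | "card X = 1" | "card X \<ge> 2" "card Y \<ge> 2" using pos by linarith
  then show ?thesis
  proof cases
    case 1
    then obtain y where "Y = {y}" by (auto simp: card_1_singleton_iff)
    then show ?thesis using single[of X y] XY k by auto
  next
    case 2
    then obtain y where "X = {y}" by (auto simp: card_1_singleton_iff)
    then have "count_estimate Y X" using single[of Y y] XY k by auto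
    then show ?thesis by (simp add: count_estimate_commute)
  next
    case 3
    then show ?thesis
      using XY k by (intro count_estimate_straddling total_error_bounded_straddling) auto
  qed
qed

section \<open>The singular series\<close>

lemma prod_ge_one_minus_sum:
  fixes g :: "'a \<Rightarrow> real"
  assumes "finite A" "\<And>i. i \<in> A \<Longrightarrow> 0 \<le> g i \<and> g i \<le> 1"
  shows "(\<Prod>i\<in>A. g i) \<ge> 1 - (\<Sum>i\<in>A. 1 - g i)"
  using assms
proof (induction A rule: finite_induct)
  case (insert i A)
  have P: "0 \<le> prod g A" "prod g A \<le> 1" using insert.prems by (auto intro: prod_nonneg prod_le_1)
  have g: "0 \<le> g i" "g i \<le> 1" using insert.prems by auto
  have "0 \<le> (1 - g i) * (1 - prod g A)" using P g by simp
  then have "g i * prod g A \<ge> g i + prod g A - 1" by (simp add: algebra_simps)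
  moreover have "prod g A \<ge> 1 - (\<Sum>i\<in>A. 1 - g i)" using insert by simp
  ultimately show ?case using insert.hyps by simp
qed simp

lemma prodinf_tail_estimate:
  fixes g :: "nat \<Rightarrow> real"
  assumes g: "\<And>i. 0 \<le> g i" "\<And>i. g i \<le> 1" and c: "\<And>i. 1 - g i \<le> c / real i ^ 2" and "n > 0"
  shows "\<bar>prodinf g - (\<Prod>i\<le>n. g i)\<bar> \<le> (\<Prod>i\<le>n. g i) * (c / real n)"
proof -
  have "c \<ge> 0" using c[of 1] g[of 1] by simp
  have "summable (\<lambda>i. norm (g i - 1))"
  proof (rule summable_comparison_test)
    show "\<exists>N. \<forall>i\<ge>N. norm (norm (g i - 1)) \<le> c * (1 / real i ^ 2)"
    proof (intro exI allI impI)
      fix i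
      show "norm (norm (g i - 1)) \<le> c * (1 / real i ^ 2)"
        using g(2)[of i] c[of i] by (simp add: abs_of_nonpos)
    qed
    show "summable (\<lambda>i. c * (1 / real i ^ 2))"
      using inverse_power_summable[of 2, where 'a = real] by (intro summable_mult) (simp add: inverse_eq_divide power_one_over)
  qed
  then have "convergent_prod g"
    by (intro abs_convergent_prod_imp_convergent_prod summable_imp_abs_convergent_prod)
  then have lim: "(\<lambda>N. \<Prod>i\<le>N. g i) \<longlonglongrightarrow> prodinf g" by (rule convergent_prod_LIMSEQ)
  have P0: "(\<Prod>i\<le>n. g i) \<ge> 0" using g by (intro prod_nonneg) auto
  have b: "\<bar>(\<Prod>i\<le>N. g i) - (\<Prod>i\<le>n. g i)\<bar> \<le> (\<Prod>i\<le>n. g i) * (c / real n)" if "N \<ge> n" for N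
  proof -
    have dec: "{..N} = {..n} \<union> {n<..N}" using that by auto
    have eq: "(\<Prod>i\<le>N. g i) = (\<Prod>i\<le>n. g i) * (\<Prod>i\<in>{n<..N}. g i)"
      unfolding dec by (rule prod.union_disjoint) auto
    have "(\<Sum>i\<in>{n<..N}. 1 - g i) \<le> (\<Sum>i\<in>{n<..N}. c * (1 / real i ^ 2))"
      using c by (intro sum_mono) simp
    also have "\<dots> \<le> c * (1 / real n)"
      unfolding sum_distrib_left[symmetric] using \<open>c \<ge> 0\<close> sum_inverse_squares_tail[OF \<open>n > 0\<close>]
      by (intro mult_left_mono) auto
    finally have "(\<Prod>i\<in>{n<..N}. g i) \<ge> 1 - c / real n"
      using prod_ge_one_minus_sum[of "{n<..N}" g] g by simp
    moreover have "(\<Prod>i\<in>{n<..N}. g i) \<le> 1" using g by (intro prod_le_1) auto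
    ultimately have "(\<Prod>i\<le>n. g i) * \<bar>(\<Prod>i\<in>{n<..N}. g i) - 1\<bar> \<le> (\<Prod>i\<le>n. g i) * (c / real n)"
      using P0 by (intro mult_left_mono) auto
    moreover have "(\<Prod>i\<le>N. g i) - (\<Prod>i\<le>n. g i) = (\<Prod>i\<le>n. g i) * ((\<Prod>i\<in>{n<..N}. g i) - 1)"
      by (simp add: eq algebra_simps)
    ultimately show ?thesis using P0 by (simp add: abs_mult)
  qed
  have "(\<lambda>N. \<bar>(\<Prod>i\<le>N. g i) - (\<Prod>i\<le>n. g i)\<bar>) \<longlonglongrightarrow> \<bar>prodinf g - (\<Prod>i\<le>n. g i)\<bar>"
    by (intro tendsto_intros lim)
  then show ?thesis by (rule LIMSEQ_le_const2) (use b in blast)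
qed

lemma F_ks_normalized:
  assumes "x > 0" "s \<le> k" "k \<ge> 1"
  shows "F_ks k s x / x ^ (k - 1) = (1 - (1 - 1 / x) ^ s) * (1 - (1 - 1 / x) ^ (k - s)) + (-1) ^ (k - 1) / x ^ k"
proof -
  define u where "u = 1 - 1 / x"
  have x1: "x - 1 = x * u" using assms by (simp add: u_def field_simps)
  have kk: "x ^ k = x ^ s * x ^ (k - s)" "u ^ k = u ^ s * u ^ (k - s)"
    using assms by (simp_all flip: power_add)
  have xk: "x ^ k = x * x ^ (k - 1)" using assms by (cases k) auto
  have "F_ks k s x / x ^ (k - 1) = (x ^ k + (x * u) ^ k - x ^ s * (x * u) ^ (k - s) - x ^ (k - s) * (x * u) ^ s
      + (-1) ^ (k - 1)) / x ^ k"
    unfolding F_ks_def x1 xk by simp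
  also have "x ^ k + (x * u) ^ k - x ^ s * (x * u) ^ (k - s) - x ^ (k - s) * (x * u) ^ s + (-1) ^ (k - 1)
      = x ^ k * ((1 - u ^ s) * (1 - u ^ (k - s))) + (-1) ^ (k - 1)"
    unfolding power_mult_distrib kk by (simp add: algebra_simps)
  finally show ?thesis using assms by (simp add: add_divide_distrib u_def)
qed

text \<open>
  With \<open>u = 1 / p\<close>, \<open>a = (1 - u) ^ s\<close> and \<open>b = (1 - u) ^ (k - s)\<close>, the Euler factor is \<open>1 - v\<close> for
  \<open>v = (1 - a) * (1 - b) + (-1) ^ (k - 1) * u ^ k\<close>.  Both \<open>1 - a\<close> and \<open>1 - b\<close> lie between \<open>u\<close>
  and a multiple of \<open>u\<close>, so \<open>v\<close> is of order \<open>u\<^sup>2\<close>; and \<open>1 - (1 - a) * (1 - b) \<ge> a \<ge> u ^ s\<close>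
  keeps the factor positive, so that the correction at the primes dividing \<open>n\<close> is well defined.
\<close>

lemma euler_factor_bounds:
  fixes k s p :: nat
  assumes k: "k \<ge> 3" "1 \<le> s" "s \<le> k - 1" and p: "prime p"
  defines "v \<equiv> F_ks k s (real p) / real p ^ (k - 1)"
  shows "0 \<le> v" "v \<le> real (s * (k - s) + 1) / real p ^ 2" "v < 1"
    and "local_factor s (k - s) n p
           = (1 - v) * (if p dvd n then 1 + (-1) ^ (k - 1) / (real p ^ (k - 1) - F_ks k s (real p)) else 1)"
    and "0 \<le> local_factor s (k - s) n p" "local_factor s (k - s) n p \<le> 1"
proof -
  define u where "u = 1 / real p"
  define a where "a = (1 - u) ^ s"
  define b where "b = (1 - u) ^ (k - s)"
  define e where "e = (-1 :: real) ^ (k - 1)"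
  have p2: "real p \<ge> 2" using prime_ge_2_nat[OF p] by simp
  have u: "0 < u" "u \<le> 1 / 2" using p2 by (auto simp: u_def divide_le_eq)
  have v: "v = (1 - a) * (1 - b) + e * u ^ k"
    using F_ks_normalized[of "real p" s k] p2 k by (simp add: v_def a_def b_def e_def u_def power_one_over)
  have e: "e = 1 \<or> e = -1" unfolding e_def by (cases "even (k - 1)") auto
  have ab: "0 \<le> a" "0 \<le> b" "a \<le> 1 - u" "b \<le> 1 - u"
    using u k power_decreasing[of 1 s "1 - u"] power_decreasing[of 1 "k - s" "1 - u"] by (auto simp: a_def b_def)
  have ua: "u ^ s \<le> a" unfolding a_def using u by (intro power_mono) auto
  have bern: "1 - a \<le> real s * u" "1 - b \<le> real (k - s) * u"
    using Bernoulli_inequality[of "- u" s] Bernoulli_inequality[of "- u" "k - s"] u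
    by (simp_all add: a_def b_def del: of_nat_diff)
  have pw: "u ^ k \<le> u ^ 2" "u ^ (k - 1) \<le> u ^ 2" "u ^ (k - 1) \<le> u ^ s" "u ^ k < u ^ s" "0 < u ^ k" "u ^ k \<le> u ^ (k - 1)"
    using u k by (auto intro!: power_decreasing power_strict_decreasing)
  have uu: "u ^ 2 \<le> (1 - a) * (1 - b)"
    unfolding power2_eq_square using ab u by (intro mult_mono) auto
  show v0: "0 \<le> v" unfolding v using e uu pw by auto
  have "(1 - a) * (1 - b) \<le> (real s * u) * (real (k - s) * u)"
    using bern ab u by (intro mult_mono) (auto simp del: of_nat_diff)
  also have "\<dots> = real (s * (k - s)) * u ^ 2" by (simp add: power2_eq_square del: of_nat_diff)
  finally have "(1 - a) * (1 - b) \<le> real (s * (k - s)) * u ^ 2" .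
  moreover have "e * u ^ k \<le> u ^ 2" using e pw by auto
  ultimately have "v \<le> real (s * (k - s)) * u ^ 2 + u ^ 2" unfolding v by (rule add_mono)
  also have "\<dots> = real (s * (k - s) + 1) / real p ^ 2"
    by (simp add: u_def power_one_over add_divide_distrib del: of_nat_diff of_nat_mult)
  finally show "v \<le> real (s * (k - s) + 1) / real p ^ 2" .
  have ge_a: "1 - (1 - a) * (1 - b) \<ge> a"
  proof -
    have "0 \<le> b * (1 - a)" using ab u by (intro mult_nonneg_nonneg) auto
    then show ?thesis by (simp add: algebra_simps)
  qed
  show v1: "v < 1" unfolding v using e ge_a ua pw by auto
  have lf: "local_factor s (k - s) n p = 1 - (1 - a) * (1 - b) + e * (of_bool (p dvd n) * u ^ (k - 1) - u ^ k)"
    using k by (simp add: local_factor_def a_def b_def e_def u_def power_one_over)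
  show "0 \<le> local_factor s (k - s) n p"
    unfolding lf using e ge_a ua pw by (auto simp: of_bool_def)
  show "local_factor s (k - s) n p \<le> 1"
    unfolding lf using e uu pw by (auto simp: of_bool_def)
  have pk: "real p ^ (k - 1) - F_ks k s (real p) = real p ^ (k - 1) * (1 - v)"
    using p2 by (simp add: v_def algebra_simps)
  show "local_factor s (k - s) n p
      = (1 - v) * (if p dvd n then 1 + (-1) ^ (k - 1) / (real p ^ (k - 1) - F_ks k s (real p)) else 1)"
  proof -
    have cancel: "w * (1 + e / (q * w)) = w + e / q" if "w > 0" "q > 0" for w q :: real
      using that by (simp add: field_simps)
    have "(1 - v) * (1 + e / (real p ^ (k - 1) * (1 - v))) = (1 - v) + e * u ^ (k - 1)"
      using cancel[of "1 - v" "real p ^ (k - 1)"] v1 p2 by (simp add: u_def power_one_over)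
    moreover have "local_factor s (k - s) n p = (1 - v) + of_bool (p dvd n) * (e * u ^ (k - 1))"
      unfolding lf v by (simp add: algebra_simps)
    ultimately show ?thesis unfolding pk e_def[symmetric] by simp
  qed
qed

text \<open>
  The primes above \<open>n\<close> do not divide \<open>n\<close> and contribute a factor \<open>1 + O(1 / n)\<close> to the infinite
  product.  The error is relative to the product of the local factors, which are probabilities and
  hence at most 1.
\<close>

lemma singular_series_estimate:
  fixes k s :: nat
  assumes k: "k \<ge> 3" "1 \<le> s" "s \<le> k - 1" and n: "n > 0"
  shows "\<bar>C_ks k s * f_ks k s n - (\<Prod>p | prime p \<and> p \<le> n. local_factor s (k - s) n p)\<bar>
           \<le> real (s * (k - s) + 1) / real n"
proof -
  define c where "c = real (s * (k - s) + 1)"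
  define g where "g = (\<lambda>p. if prime p then 1 - F_ks k s (real p) / real p ^ (k - 1) else 1 :: real)"
  define Q where "Q = {p. prime p \<and> p \<le> n}"
  define h where "h = (\<lambda>p. 1 + (-1) ^ (k - 1) / (real p ^ (k - 1) - F_ks k s (real p)))"
  have finQ: "finite Q" unfolding Q_def by (rule finite_subset[of _ "{..n}"]) auto
  note ef = euler_factor_bounds[OF k]
  have g: "0 \<le> g i" "g i \<le> 1" "1 - g i \<le> c / real i ^ 2" for i
    using ef(1-3)[of i] by (auto simp: g_def c_def)
  have "\<bar>C_ks k s - (\<Prod>i\<le>n. g i)\<bar> \<le> (\<Prod>i\<le>n. g i) * (c / real n)"
    unfolding C_ks_def using prodinf_tail_estimate[OF g n] by (simp add: g_def)
  then have "\<bar>C_ks k s - (\<Prod>i\<le>n. g i)\<bar> * \<bar>f_ks k s n\<bar> \<le> (\<Prod>i\<le>n. g i) * (c / real n) * \<bar>f_ks k s n\<bar>"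
    by (rule mult_right_mono) simp
  moreover have P0: "(\<Prod>i\<le>n. g i) \<ge> 0" using g by (intro prod_nonneg) auto
  moreover have main: "(\<Prod>p\<in>Q. local_factor s (k - s) n p) = (\<Prod>i\<le>n. g i) * f_ks k s n"
  proof -
    have "(\<Prod>p\<in>Q. local_factor s (k - s) n p) = (\<Prod>p\<in>Q. g p) * (\<Prod>p\<in>Q. if p dvd n then h p else 1)"
      unfolding prod.distrib[symmetric] using ef(4) by (intro prod.cong) (auto simp: Q_def g_def h_def)
    also have "(\<Prod>p\<in>Q. g p) = (\<Prod>i\<le>n. g i)"
      by (rule prod.mono_neutral_left) (auto simp: Q_def g_def)
    also have "(\<Prod>p\<in>Q. if p dvd n then h p else 1) = (\<Prod>p | p \<in> Q \<and> p dvd n. h p)"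
      using finQ by (simp add: prod.inter_filter)
    also have "{p. p \<in> Q \<and> p dvd n} = {p. prime p \<and> p dvd n}"
      using n dvd_imp_le by (auto simp: Q_def)
    finally show ?thesis by (simp add: f_ks_def h_def)
  qed
  moreover have "\<bar>\<Prod>p\<in>Q. local_factor s (k - s) n p\<bar> \<le> 1"
    unfolding abs_prod using ef(5,6) by (intro prod_le_1) (auto simp: Q_def)
  ultimately have "\<bar>C_ks k s * f_ks k s n - (\<Prod>p\<in>Q. local_factor s (k - s) n p)\<bar>
      \<le> \<bar>\<Prod>p\<in>Q. local_factor s (k - s) n p\<bar> * (c / real n)"
    unfolding main left_diff_distrib[symmetric] abs_mult by (simp add: mult_ac)
  also have "\<dots> \<le> 1 * (c / real n)"
    using \<open>\<bar>\<Prod>p\<in>Q. local_factor s (k - s) n p\<bar> \<le> 1\<close> by (intro mult_right_mono) (auto simp: c_def)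
  finally show ?thesis by (simp add: Q_def c_def)
qed

section \<open>The asymptotic formula\<close>

theorem theorem2p1:
  fixes k s :: nat
  assumes "k \<ge> 3" and "1 \<le> s" and "s \<le> k - 1"
  shows "(\<lambda>n::nat. real (A_ks k s n) - C_ks k s * f_ks k s n * (real n ^ (k - 1) / fact (k - 1)))
           \<in> O(\<lambda>n. if k \<ge> 4 then real n ^ (k - 2) * ln (real n) ^ max s (k - s)
                   else real n * ln (real n) ^ 2 * ln (ln (real n)))"
proof -
  define M where "M = max s (k - s)"
  define c where "c = real (s * (k - s) + 1)"
  have card: "card {1..s} = s" "card {s+1..k} = k - s" "{1..s} \<union> {s+1..k} = {1..k}" "s + (k - s) = k"
    using assms by auto
  have "count_estimate {1..s} {s+1..k}" using assms by (intro count_estimate) auto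
  then obtain C where C: "\<And>n. n > 0 \<Longrightarrow> \<bar>real (coprime_count {1..s} {s+1..k} n)
      - real n ^ (k - 1) / fact (k - 1) * (\<Prod>p | prime p \<and> p \<le> n. local_factor s (k - s) n p)\<bar>
      \<le> C * (real n ^ (k - 2) * (1 + ln (real n)) ^ M)"
    unfolding count_estimate_def card M_def by blast
  have A: "A_ks k s n = coprime_count {1..s} {s+1..k} n" for n
    unfolding A_ks_def coprime_count_def card by (simp only: coprime_iff_gcd_eq_1)
  define err where "err = (\<lambda>n. real (A_ks k s n) - C_ks k s * f_ks k s n * (real n ^ (k - 1) / fact (k - 1)))"
  have bound: "\<bar>err n\<bar> \<le> (\<bar>C\<bar> * 2 ^ M + c) * (real n ^ (k - 2) * ln (real n) ^ M)" if n: "real n \<ge> exp 1" for n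
  proof -
    have n0: "n > 0" using n by (metis exp_gt_zero of_nat_0_less_iff order_less_le_trans)
    have l: "ln (real n) \<ge> 1" using n n0 ln_mono[of "exp 1" "real n"] by simp
    define P where "P = (\<Prod>p | prime p \<and> p \<le> n. local_factor s (k - s) n p)"
    define m where "m = real n ^ (k - 1) / fact (k - 1)"
    have m: "0 \<le> m" "m \<le> real n ^ (k - 1)"
      unfolding m_def by (auto simp: divide_le_eq mult_le_cancel_left1 fact_ge_1)
    have "err n = (real (A_ks k s n) - m * P) - (C_ks k s * f_ks k s n - P) * m"
      unfolding err_def m_def[symmetric] by (simp add: algebra_simps)
    then have "\<bar>err n\<bar> \<le> \<bar>real (A_ks k s n) - m * P\<bar> + \<bar>C_ks k s * f_ks k s n - P\<bar> * m"
      using m by (metis abs_mult abs_of_nonneg abs_triangle_ineq4)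
    also have "\<dots> \<le> C * (real n ^ (k - 2) * (1 + ln (real n)) ^ M) + c / real n * real n ^ (k - 1)"
      unfolding A P_def m_def c_def
      using m by (intro add_mono mult_mono C[OF n0] singular_series_estimate[OF assms n0]) (auto simp: m_def)
    also have "c / real n * real n ^ (k - 1) = c * (real n ^ (k - 2) * 1)"
    proof -
      have "k - 1 = Suc (k - 2)" using assms by simp
      then show ?thesis using n0 by simp
    qed
    also have "\<dots> \<le> c * (real n ^ (k - 2) * ln (real n) ^ M)"
      using l by (intro mult_left_mono one_le_power) (auto simp: c_def)
    also have "C * (real n ^ (k - 2) * (1 + ln (real n)) ^ M) \<le> \<bar>C\<bar> * (real n ^ (k - 2) * (2 * ln (real n)) ^ M)"
      using l by (intro mult_mono power_mono) auto
    finally show ?thesis by (simp add: algebra_simps power_mult_distrib)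
  qed
  show ?thesis
  proof (rule bigoI)
    have "\<forall>\<^sub>F n in sequentially. real n \<ge> exp (exp 1)"
      using filterlim_real_sequentially unfolding filterlim_at_top by blast
    then show "\<forall>\<^sub>F n in sequentially. norm (real (A_ks k s n) - C_ks k s * f_ks k s n * (real n ^ (k - 1) / fact (k - 1)))
        \<le> (\<bar>C\<bar> * 2 ^ M + c) * norm (if k \<ge> 4 then real n ^ (k - 2) * ln (real n) ^ max s (k - s)
                   else real n * ln (real n) ^ 2 * ln (ln (real n)))"
    proof eventually_elim
      case (elim n)
      have "exp 1 \<le> exp (exp (1 :: real))" using exp_ge_add_one_self[of "1 :: real"] by simp
      then have n: "real n \<ge> exp 1" using elim by linarith
      have n0: "real n > 0" using n exp_gt_zero[of "1 :: real"] by linarith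
      have l: "ln (real n) \<ge> exp 1" using elim n0 by (simp add: ln_ge_iff)
      have l0: "ln (real n) > 0" using l exp_gt_zero[of "1 :: real"] by linarith
      have ll: "ln (ln (real n)) \<ge> 1" using l l0 by (simp add: ln_ge_iff)
      have b0: "real n ^ (k - 2) * ln (real n) ^ M \<ge> 0" using l0 by simp
      have "real n ^ (k - 2) * ln (real n) ^ M \<le> norm (if k \<ge> 4 then real n ^ (k - 2) * ln (real n) ^ max s (k - s)
                   else real n * ln (real n) ^ 2 * ln (ln (real n)))"
      proof (cases "k \<ge> 4")
        case True
        then show ?thesis by (simp add: M_def)
      next
        case False
        then have "k = 3" "M = 2" using assms by (auto simp: M_def max_def)
        have "real n * ln (real n) ^ 2 * 1 \<le> real n * ln (real n) ^ 2 * ln (ln (real n))"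
          using ll by (intro mult_left_mono) auto
        then show ?thesis using \<open>k = 3\<close> \<open>M = 2\<close> ll l0 by simp
      qed
      then have "(\<bar>C\<bar> * 2 ^ M + c) * (real n ^ (k - 2) * ln (real n) ^ M)
        \<le> (\<bar>C\<bar> * 2 ^ M + c) * norm (if k \<ge> 4 then real n ^ (k - 2) * ln (real n) ^ max s (k - s)
                   else real n * ln (real n) ^ 2 * ln (ln (real n)))"
        by (intro mult_left_mono) (auto simp: c_def)
      then show ?case using bound[OF n] by (simp add: err_def)
    qed
  qed
qed

end
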